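(* Let $\mathbb{F}$ be an ordered field and let $\mathcal{A}_1,\mathcal{A}_2$ be two line arrangements of $n$ lines in $\mathbb{F}^2$, with sets of intersection points $\mathcal{P}_1,\mathcal{P}_2$ respectively. Let $\phi:\mathcal{P}_1\to\mathcal{P}_2$ be a bijection such that whenever three points of $\mathcal{P}_1$ lie on a common line of $\mathcal{A}_1$, their images lie on a common line of $\mathcal{A}_2$ (a line arrangement collineation isomorphism). Suppose moreover that $\phi$ preserves the order of intersection points on each line: for every line $L\in\mathcal{A}_1$, $\phi(\mathcal{P}_1\cap L)=\mathcal{P}_2\cap L'$ for a line $L'\in\mathcal{A}_2$, and the restriction $\phi:\mathcal{P}_1\cap L\to\mathcal{P}_2\cap L'$ is monotone (order preserving or order reversing) with respect to the linear orders induced on $L$ and $L'$ by linear parametrizations $t\mapsto v+tw$, $t\in\mathbb{F}$. Then there exists a piecewise linear automorphism of $\mathbb{F}^2$ which takes the arrangement $\mathcal{A}_1$ to the arrangement $\mathcal{A}_2$.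
   Context: An ordered field is a totally ordered field with $x\le y\Rightarrow x+z\le y+z$ and $x,y\ge 0\Rightarrow xy\ge0$ (the paper calls this a field with $1$-ad structure). A line arrangement of $n$ lines in $\mathbb{F}^2$ is a set of $n$ lines with no two parallel and no three concurrent; its set of intersection points is $\{L_i\cap L_j: i<j\}$. A piecewise linear automorphism of $\mathbb{F}^2$ is a bijection $\mathbb{F}^2\to\mathbb{F}^2$ which is affine on each piece of a finite decomposition of the plane into convex polygonal pieces (finite intersections of closed half-planes); it takes $\mathcal{A}_1$ to $\mathcal{A}_2$ if it maps the lines of $\mathcal{A}_1$ onto the lines of $\mathcal{A}_2$. *)

theory Defs
  imports "HOL-Analysis.Finite_Cartesian_Product"
begin

text \<open>
  The plane over an ordered field is \<open>'a ^ 2\<close> with \<open>'a :: linordered_field\<close>. The library's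
  notions of affine sets, convexity and polyhedra are tied to real vector spaces, so the few
  that are needed are introduced here over an arbitrary ordered field.
\<close>

definition line_through :: "'a::linordered_field ^ 2 \<Rightarrow> 'a ^ 2 \<Rightarrow> ('a ^ 2) set" where
  "line_through v w = {v + t *s w | t. True}"

definition is_line :: "('a::linordered_field ^ 2) set \<Rightarrow> bool" where
  "is_line L \<longleftrightarrow> (\<exists>v w. w \<noteq> 0 \<and> L = line_through v w)"

definition parallel_lines :: "('a::linordered_field ^ 2) set \<Rightarrow> ('a ^ 2) set \<Rightarrow> bool" where
  "parallel_lines L M \<longleftrightarrow>
     (\<exists>v v' w. w \<noteq> 0 \<and> L = line_through v w \<and> M = line_through v' w)"

definition line_arrangement :: "nat \<Rightarrow> ('a::linordered_field ^ 2) set set \<Rightarrow> bool" where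
  "line_arrangement n A \<longleftrightarrow>
     finite A \<and> card A = n \<and> (\<forall>L\<in>A. is_line L) \<and>
     (\<forall>L\<in>A. \<forall>M\<in>A. L \<noteq> M \<longrightarrow> \<not> parallel_lines L M) \<and>
     (\<forall>L\<in>A. \<forall>M\<in>A. \<forall>N\<in>A. L \<noteq> M \<and> L \<noteq> N \<and> M \<noteq> N \<longrightarrow> L \<inter> M \<inter> N = {})"

definition intersection_points :: "('a::linordered_field ^ 2) set set \<Rightarrow> ('a ^ 2) set" where
  "intersection_points A = {p. \<exists>L\<in>A. \<exists>M\<in>A. L \<noteq> M \<and> p \<in> L \<inter> M}"

definition collineation_isomorphism ::
  "('a::linordered_field ^ 2) set set \<Rightarrow> ('a ^ 2) set set \<Rightarrow> ('a ^ 2 \<Rightarrow> 'a ^ 2) \<Rightarrow> bool" where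
  "collineation_isomorphism A B \<phi> \<longleftrightarrow>
     bij_betw \<phi> (intersection_points A) (intersection_points B) \<and>
     (\<forall>p\<in>intersection_points A. \<forall>q\<in>intersection_points A. \<forall>r\<in>intersection_points A.
        p \<noteq> q \<and> p \<noteq> r \<and> q \<noteq> r \<and> (\<exists>L\<in>A. {p, q, r} \<subseteq> L) \<longrightarrow>
        (\<exists>L'\<in>B. {\<phi> p, \<phi> q, \<phi> r} \<subseteq> L'))"

definition param_le ::
  "'a::linordered_field ^ 2 \<Rightarrow> 'a ^ 2 \<Rightarrow> 'a ^ 2 \<Rightarrow> 'a ^ 2 \<Rightarrow> bool" where
  "param_le v w p q \<longleftrightarrow> (\<exists>s t. p = v + s *s w \<and> q = v + t *s w \<and> s \<le> t)"

text \<open>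
  Changing the linear parametrization of a line either keeps or reverses the induced order, so
  the following property does not depend on which parametrizations of \<open>L\<close> and \<open>L'\<close> are taken.
\<close>

definition monotone_between_lines ::
  "('a::linordered_field ^ 2 \<Rightarrow> 'a ^ 2) \<Rightarrow> ('a ^ 2) set \<Rightarrow> ('a ^ 2) set \<Rightarrow> ('a ^ 2) set \<Rightarrow> bool" where
  "monotone_between_lines \<phi> S L L' \<longleftrightarrow>
     (\<exists>v w v' w'. w \<noteq> 0 \<and> w' \<noteq> 0 \<and> L = line_through v w \<and> L' = line_through v' w' \<and>
        (monotone_on S (param_le v w) (param_le v' w') \<phi> \<or>
         monotone_on S (param_le v w) (\<lambda>x y. param_le v' w' y x) \<phi>))"

definition preserves_order_on_lines ::
  "('a::linordered_field ^ 2) set set \<Rightarrow> ('a ^ 2) set set \<Rightarrow> ('a ^ 2 \<Rightarrow> 'a ^ 2) \<Rightarrow> bool" where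
  "preserves_order_on_lines A B \<phi> \<longleftrightarrow>
     (\<forall>L\<in>A. \<exists>L'\<in>B.
        \<phi> ` (intersection_points A \<inter> L) = intersection_points B \<inter> L' \<and>
        monotone_between_lines \<phi> (intersection_points A \<inter> L) L L')"

definition closed_half_plane :: "('a::linordered_field ^ 2) set \<Rightarrow> bool" where
  "closed_half_plane H \<longleftrightarrow> (\<exists>(a :: 'a ^ 2) c. a \<noteq> 0 \<and> H = {x. a $ 1 * x $ 1 + a $ 2 * x $ 2 \<le> c})"

text \<open>Pieces may be unbounded; the whole plane is the empty intersection.\<close>

definition convex_polygonal :: "('a::linordered_field ^ 2) set \<Rightarrow> bool" where
  "convex_polygonal P \<longleftrightarrow> (\<exists>\<H>. finite \<H> \<and> (\<forall>H\<in>\<H>. closed_half_plane H) \<and> P = \<Inter>\<H>)"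

text \<open>
  For convex pieces, meeting inside a line expresses that distinct pieces have no common interior
  point. Pieces with empty interior are not excluded, but are redundant: being closed, the
  two-dimensional pieces already cover the plane.
\<close>

definition polygonal_decomposition :: "('a::linordered_field ^ 2) set set \<Rightarrow> bool" where
  "polygonal_decomposition \<D> \<longleftrightarrow>
     finite \<D> \<and> (\<forall>P\<in>\<D>. convex_polygonal P) \<and> \<Union>\<D> = UNIV \<and>
     (\<forall>P\<in>\<D>. \<forall>Q\<in>\<D>. P \<noteq> Q \<longrightarrow> (\<exists>L. is_line L \<and> P \<inter> Q \<subseteq> L))"

definition affine_on :: "('a::linordered_field ^ 2) set \<Rightarrow> ('a ^ 2 \<Rightarrow> 'a ^ 2) \<Rightarrow> bool" where
  "affine_on P f \<longleftrightarrow> (\<exists>(M :: 'a ^ 2 ^ 2) b. \<forall>x\<in>P. f x = M *v x + b)"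

definition piecewise_linear_automorphism :: "('a::linordered_field ^ 2 \<Rightarrow> 'a ^ 2) \<Rightarrow> bool" where
  "piecewise_linear_automorphism f \<longleftrightarrow>
     bij f \<and> (\<exists>\<D>. polygonal_decomposition \<D> \<and> (\<forall>P\<in>\<D>. affine_on P f))"

definition takes_arrangement ::
  "('a::linordered_field ^ 2 \<Rightarrow> 'a ^ 2) \<Rightarrow> ('a ^ 2) set set \<Rightarrow> ('a ^ 2) set set \<Rightarrow> bool" where
  "takes_arrangement f A B \<longleftrightarrow> (\<lambda>L. f ` L) ` A = B"

end

theory Submission
  imports Defs "HOL-Analysis.Cartesian_Space"
begin

text \<open>
  Homogenize: a line becomes a linear form on \<open>F\<^sup>3\<close>, and the line at infinity, the form \<open>z\<close>, joins the
  arrangement. The order of the points on a line \<open>a\<close> is read off from the signs of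
  \<open>det(a, b, c) det(a, b, z) det(a, c, z)\<close>; comparing them for both arrangements yields signs by which
  the forms of the second arrangement can be rescaled so that all \<open>3 \<times> 3\<close> determinants agree in
  sign, up to one global sign. Hence the extreme rays of the cells of both central arrangements
  correspond, and so do their sign vectors. Enumerate the rays. Every \<open>x \<noteq> 0\<close> is
  \<open>t v + y\<close>, where \<open>v\<close> is the first ray of the closed face of \<open>x\<close> and \<open>t\<close> is as large as possible;
  iterating with \<open>y\<close> gives a unique expansion of \<open>x\<close> which only depends on sign vectors (this is the
  pulling triangulation of the cells). Replacing each \<open>v\<close> by its partner gives a conewise linear
  bijection preserving all signs, and with rays normalized to \<open>z \<in> {0, \<plusminus>1}\<close> also \<open>z\<close>; restrict it to
  the plane \<open>z = 1\<close>.
\<close>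

section \<open>Expansions along conformal vertices\<close>

text \<open>Homogenizing helps because an unbounded cell of the plane is not the hull of its
  vertices, whereas every cell of an essential central arrangement is generated by its extreme rays.
  The difficulty is to triangulate all cells so that neighbours agree on common faces and both
  arrangements are cut in the same way. Taking the first ray of one global enumeration settles both:
  the choice depends only on which rays lie in the closed face of the point, so nothing has to be
  glued. The inverse is the same construction with the arrangements exchanged. The rescaling signs
  exist for a cohomological reason. Let \<open>r2 i j\<close> and \<open>r3 i j k\<close> be the
  sign ratios between the two arrangements of det(i, j, z) and det(i, j, k). Both are symmetric, and
  order preservation says \<open>r3 i j k = \<eta> i * r2 i j * r2 i k\<close>, where
  \<open>\<eta> i\<close> depends on the line i only. Interchanging i and j shows that
  \<open>r2 i k * \<eta> i * \<eta> k\<close> does not change with i; by symmetry it is a constant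
  \<delta>, the global sign.\<close>

definition linear_form :: "('a::field ^ 'n \<Rightarrow> 'a) \<Rightarrow> bool" where
  "linear_form m \<longleftrightarrow> (\<forall>x y. m (x + y) = m x + m y) \<and> (\<forall>c x. m (c *s x) = c * m x)"

lemma linear_form_add: "linear_form m \<Longrightarrow> m (x + y) = m x + m y"
  and linear_form_scale: "linear_form m \<Longrightarrow> m (c *s x) = c * m x"
  by (auto simp: linear_form_def)

lemma linear_form_0: "linear_form m \<Longrightarrow> m 0 = 0"
  using linear_form_scale[of m 0 0] by simp

lemma linear_form_diff: "linear_form m \<Longrightarrow> m (x - y) = m x - m y"
  using linear_form_add[of m "x - y" y] by simp

lemmas linear_form_simps =
  linear_form_add linear_form_scale linear_form_0 linear_form_diff

definition linear_map :: "('a::field ^ 'n \<Rightarrow> 'a ^ 'm) \<Rightarrow> bool" where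
  "linear_map T \<longleftrightarrow> (\<forall>x y. T (x + y) = T x + T y) \<and> (\<forall>c x. T (c *s x) = c *s T x)"

text \<open>
  \<open>u\<close> lies in the closed face of the hyperplane arrangement whose relative interior contains \<open>x\<close>.
\<close>

definition conformal ::
  "'i set \<Rightarrow> ('i \<Rightarrow> 'a::linordered_field ^ 'n \<Rightarrow> 'a) \<Rightarrow> 'a ^ 'n \<Rightarrow> 'a ^ 'n \<Rightarrow> bool" where
  "conformal I l u x \<longleftrightarrow> (\<forall>i\<in>I. l i u = 0 \<or> sgn (l i u) = sgn (l i x))"

lemma conformal_trans: "conformal I l u x \<Longrightarrow> conformal I l x y \<Longrightarrow> conformal I l u y"
  by (fastforce simp: conformal_def sgn_0_0)

lemma sgn_add_same:
  fixes a b :: "'a::linordered_field"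
  assumes "a = 0 \<or> sgn a = s" "b = 0 \<or> sgn b = s"
  shows "a + b = 0 \<or> sgn (a + b) = s"
  using assms by (auto simp: sgn_if split: if_splits)

lemma sgn_add_conformal:
  fixes a b c :: "'a::linordered_field"
  assumes "0 < c" "a \<noteq> 0" "b = 0 \<or> sgn b = sgn a"
  shows "sgn (c * a + b) = sgn a"
proof (cases "a > 0")
  case True
  then have "b \<ge> 0" "c * a > 0" using assms by (auto simp: sgn_if split: if_splits)
  then show ?thesis using True by (simp add: sgn_if add_pos_nonneg)
next
  case False
  then have "a < 0" using assms by auto
  then have "b \<le> 0" "c * a < 0"
    using assms by (auto simp: sgn_if mult_pos_neg split: if_splits)
  then have "c * a + b < 0" by linarith
  then show ?thesis using \<open>a < 0\<close> by (simp add: sgn_if)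
qed

definition support :: "'i set \<Rightarrow> ('i \<Rightarrow> 'a::linordered_field ^ 'n \<Rightarrow> 'a) \<Rightarrow> 'a ^ 'n \<Rightarrow> 'i set" where
  "support I l x = {i\<in>I. l i x \<noteq> 0}"

text \<open>Move from \<open>x\<close> in direction \<open>- u\<close> until the first hyperplane is hit.\<close>

lemma exists_conformal_exit:
  fixes l :: "'i \<Rightarrow> 'a::linordered_field ^ 'n \<Rightarrow> 'a"
  assumes fin: "finite I" and lin: "\<And>i. i \<in> I \<Longrightarrow> linear_form (l i)"
    and zero: "\<And>i. i \<in> I \<Longrightarrow> l i x = 0 \<Longrightarrow> l i u = 0"
    and ex: "\<exists>i\<in>I. l i u * l i x > 0"
  shows "\<exists>t>0. conformal I l (x - t *s u) x \<and>
    (\<exists>i\<in>I. l i u \<noteq> 0 \<and> l i x \<noteq> 0 \<and> l i (x - t *s u) = 0)"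
proof -
  \<comment> \<open>Along \<open>- u\<close> only a form with the same strict sign at
    \<open>u\<close> and \<open>x\<close> moves towards zero, which it reaches at
    \<open>l i x / l i u\<close>. The forms outside \<open>S\<close> never change sign.\<close>
  define S where "S = {i\<in>I. l i u * l i x > 0}"
  define t where "t = Min ((\<lambda>i. l i x / l i u) ` S)"
  have S: "finite S" "S \<noteq> {}" using fin ex by (auto simp: S_def)
  then have "t \<in> (\<lambda>i. l i x / l i u) ` S" unfolding t_def by (intro Min_in) auto
  then obtain k where k: "k \<in> S" "t = l k x / l k u" by auto
  have t0: "t > 0" using k by (auto simp: S_def zero_less_mult_iff zero_less_divide_iff)
  have tle: "t \<le> l i x / l i u" if "i \<in> S" for i
    unfolding t_def using S that by (intro Min_le) auto
  have "l i (x - t *s u) = 0 \<or> sgn (l i (x - t *s u)) = sgn (l i x)" if i: "i \<in> I" for i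
  proof (cases "i \<in> S")
    case True
    then have le: "t \<le> l i x / l i u" by (rule tle)
    from True have "l i u * l i x > 0" by (simp add: S_def)
    then consider "l i u > 0" "l i x > 0" | "l i u < 0" "l i x < 0"
      by (auto simp: zero_less_mult_iff)
    then show ?thesis
    proof cases
      case 1
      then have "t * l i u \<le> l i x" using le by (simp add: pos_le_divide_eq)
      then show ?thesis using 1 i by (auto simp: linear_form_simps lin sgn_if)
    next
      case 2
      then have "t * l i u \<ge> l i x" using le by (simp add: neg_le_divide_eq)
      then show ?thesis using 2 i by (auto simp: linear_form_simps lin sgn_if)
    qed
  next
    case False
    then have "l i u * l i x \<le> 0" using i by (auto simp: S_def)
    then consider "l i x = 0" | "l i x > 0" "l i u \<le> 0" | "l i x < 0" "l i u \<ge> 0"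
      by (cases "l i x" "0 :: 'a" rule: linorder_cases) (auto simp: mult_le_0_iff)
    then show ?thesis
    proof cases
      case 1
      then show ?thesis using zero[OF i] i by (simp add: linear_form_simps lin)
    next
      case 2
      then have "t * l i u \<le> 0" using t0 by (simp add: mult_nonneg_nonpos)
      then have "l i x - t * l i u > 0" using 2 by linarith
      then show ?thesis using 2 i by (simp add: linear_form_simps lin)
    next
      case 3
      then have "t * l i u \<ge> 0" using t0 by simp
      then have "l i x - t * l i u < 0" using 3 by linarith
      then show ?thesis using 3 i by (simp add: linear_form_simps lin)
    qed
  qed
  moreover have "k \<in> I" "l k u \<noteq> 0" "l k x \<noteq> 0" using k(1) by (auto simp: S_def)
  moreover have "l k (x - t *s u) = 0"
    using k(2) calculation(2,3) by (simp add: linear_form_simps lin)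
  ultimately show ?thesis using t0 unfolding conformal_def by blast
qed

text \<open>A list rather than a coefficient function: the order of the entries records the order in
  which the vertices are subtracted.\<close>

primrec combination :: "('k \<Rightarrow> 'a::linordered_field ^ 'n) \<Rightarrow> ('k \<times> 'a) list \<Rightarrow> 'a ^ 'n" where
  "combination v [] = 0"
| "combination v (p # s) = snd p *s v (fst p) + combination v s"

lemma linear_form_combination_eq:
  assumes "linear_form m" "linear_form m'" "\<And>p. p \<in> set s \<Longrightarrow> m (v (fst p)) = m' (v' (fst p))"
  shows "m (combination v s) = m' (combination v' s)"
  using assms(3) by (induction s) (auto simp: linear_form_simps assms(1,2))

lemma combination_filter_pos:
  "(\<forall>p\<in>set s. 0 \<le> snd p) \<Longrightarrow> combination v (filter (\<lambda>p. 0 < snd p) s) = combination v s"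
  by (induction s) (auto simp: order_le_less)

definition polyhedral_cone :: "('a::linordered_field ^ 'n) set \<Rightarrow> bool" where
  "polyhedral_cone C \<longleftrightarrow>
     (\<exists>M. finite M \<and> (\<forall>m\<in>M. linear_form m) \<and> C = {x. \<forall>m\<in>M. 0 \<le> m x})"

text \<open>Coefficients may vanish here, unlike in an admissible expansion, so that the pieces come
  out closed.\<close>

definition generated_cone :: "('k \<Rightarrow> 'a::linordered_field ^ 'n) \<Rightarrow> 'k list \<Rightarrow> ('a ^ 'n) set" where
  "generated_cone v ks = {combination v s | s. map fst s = ks \<and> (\<forall>p\<in>set s. 0 \<le> snd p)}"

text \<open>Models the extreme rays of the cells of an essential central arrangement. Of extremality
  only one consequence is kept: the closed face of every nonzero point contains some
  \<open>v k\<close>. Repetitions in the enumeration are therefore harmless.\<close>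

locale vertex_system =
  fixes I :: "'i set" and l :: "'i \<Rightarrow> 'a::linordered_field ^ 'n \<Rightarrow> 'a"
    and K :: nat and v :: "nat \<Rightarrow> 'a ^ 'n"
  assumes fin: "finite I" and lin: "\<And>i. i \<in> I \<Longrightarrow> linear_form (l i)"
    and essential: "\<And>x. (\<And>i. i \<in> I \<Longrightarrow> l i x = 0) \<Longrightarrow> x = 0"
    and vertex_nonzero: "\<And>k. k < K \<Longrightarrow> v k \<noteq> 0"
    and vertex_exists: "\<And>x. x \<noteq> 0 \<Longrightarrow> \<exists>k<K. conformal I l (v k) x"
begin

definition first_vertex :: "'a ^ 'n \<Rightarrow> nat \<Rightarrow> bool" where
  "first_vertex x k \<longleftrightarrow> k < K \<and> conformal I l (v k) x \<and> (\<forall>j<k. \<not> conformal I l (v j) x)"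

text \<open>
  The admissible expansions are those produced by repeatedly subtracting the largest possible
  multiple of the first conformal vertex; they describe the pulling triangulation.
\<close>

primrec admissible :: "(nat \<times> 'a) list \<Rightarrow> bool" where
  "admissible [] \<longleftrightarrow> True"
| "admissible (p # s) \<longleftrightarrow> 0 < snd p \<and> admissible s \<and>
     first_vertex (combination v (p # s)) (fst p) \<and>
     conformal I l (combination v s) (combination v (p # s)) \<and>
     (\<exists>i\<in>I. l i (v (fst p)) \<noteq> 0 \<and> l i (combination v s) = 0)"

lemma first_vertex_exists: "x \<noteq> 0 \<Longrightarrow> \<exists>k. first_vertex x k"
proof -
  assume "x \<noteq> 0"
  then have ex: "\<exists>k. k < K \<and> conformal I l (v k) x" using vertex_exists by blast
  let ?k = "LEAST k. k < K \<and> conformal I l (v k) x"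
  have "?k < K \<and> conformal I l (v ?k) x" using ex by (rule LeastI_ex)
  moreover have "\<not> conformal I l (v j) x" if "j < ?k" for j
    using not_less_Least[OF that] that calculation by auto
  ultimately show ?thesis unfolding first_vertex_def by blast
qed

lemma first_vertex_unique: "first_vertex x j \<Longrightarrow> first_vertex x k \<Longrightarrow> j = k"
  by (metis first_vertex_def linorder_less_linear)

lemma vertex_form_nonzero: "k < K \<Longrightarrow> \<exists>i\<in>I. l i (v k) \<noteq> 0"
  using essential vertex_nonzero by blast

lemma finite_support: "finite (support I l x)"
  using fin by (simp add: support_def)

lemma support_psubset:
  "conformal I l y x \<Longrightarrow> i \<in> I \<Longrightarrow> l i x \<noteq> 0 \<Longrightarrow> l i y = 0 \<Longrightarrow> support I l y \<subset> support I l x"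
  unfolding support_def conformal_def by (auto simp: sgn_0_0)

text \<open>Subtracting the largest conformal multiple of the first vertex makes a further form
  vanish and keeps all zeros, so the support strictly shrinks.\<close>

lemma admissible_exists: "\<exists>s. admissible s \<and> combination v s = x"
proof (induction "card (support I l x)" arbitrary: x rule: less_induct)
  case less
  show ?case
  proof (cases "x = 0")
    case True
    then show ?thesis by (intro exI[of _ "[]"]) simp
  next
    case False
    then obtain k where k: "first_vertex x k" using first_vertex_exists by blast
    then have kK: "k < K" and conf: "conformal I l (v k) x" by (auto simp: first_vertex_def)
    obtain j where j: "j \<in> I" "l j (v k) \<noteq> 0" using vertex_form_nonzero kK by blast
    then have sg: "sgn (l j (v k)) = sgn (l j x)" using conf by (auto simp: conformal_def)
    have "l j (v k) * l j x > 0"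
      using sg j(2) by (auto simp: sgn_if zero_less_mult_iff split: if_splits)
    moreover have "l i (v k) = 0" if "i \<in> I" "l i x = 0" for i
      using conf that by (auto simp: conformal_def sgn_0_0)
    ultimately obtain t i where t: "t > 0" "conformal I l (x - t *s v k) x" "i \<in> I"
      "l i (v k) \<noteq> 0" "l i x \<noteq> 0" "l i (x - t *s v k) = 0"
      using exists_conformal_exit[of I l x "v k"] fin lin j(1) by metis
    then have "support I l (x - t *s v k) \<subset> support I l x" by (intro support_psubset) auto
    then have "card (support I l (x - t *s v k)) < card (support I l x)"
      using finite_support by (simp add: psubset_card_mono)
    from less[OF this] obtain s where s: "admissible s" "combination v s = x - t *s v k" by blast
    then have "combination v ((k, t) # s) = x" by simp
    moreover from this have "admissible ((k, t) # s)" using s t k by auto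
    ultimately show ?thesis by blast
  qed
qed

text \<open>The point determines its first vertex, and the last clause of \<open>admissible\<close>
  forces the coefficient to be the largest possible one. So the heads agree, and the tails follow by
  induction.\<close>

lemma admissible_unique:
  "admissible s \<Longrightarrow> admissible s' \<Longrightarrow> combination v s = combination v s' \<Longrightarrow> s = s'"
proof (induction s arbitrary: s')
  case Nil
  show ?case
  proof (cases s')
    case (Cons p q)
    then have "first_vertex 0 (fst p)" using Nil by auto
    then have "fst p < K" "conformal I l (v (fst p)) 0" by (auto simp: first_vertex_def)
    then show ?thesis using vertex_form_nonzero[of "fst p"]
      by (auto simp: conformal_def linear_form_0 lin sgn_0_0)
  qed simp
next
  case (Cons p s)
  note IH = Cons.IH and prems = Cons.prems
  show ?case
  proof (cases s')
    case Nil
    then have "first_vertex 0 (fst p)" using prems by auto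
    then have "fst p < K" "conformal I l (v (fst p)) 0" by (auto simp: first_vertex_def)
    then show ?thesis using vertex_form_nonzero[of "fst p"]
      by (auto simp: conformal_def linear_form_0 lin sgn_0_0)
  next
    case (Cons p' q)
    \<comment> \<open>At a form \<open>l i\<close> vanishing on \<open>y\<close> the point takes the
      value \<open>c * l i (v k)\<close>. With \<open>c' > c\<close> the remainder \<open>y'\<close>
      would have the opposite sign there and leave the closed face of the point.\<close>
    have bound: "c' \<le> c" if i: "i \<in> I" "l i (v k) \<noteq> 0" "l i y = 0" and c: "0 < c" "0 < c'"
      and eq: "c *s v k + y = c' *s v k + y'" and cf: "conformal I l y' (c' *s v k + y')"
      for i k c c' y y'
    proof -
      have e: "c * l i (v k) = c' * l i (v k) + l i y'"
        using arg_cong[OF eq, of "l i"] i by (simp add: linear_form_simps lin)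
      moreover have "l i y' = 0 \<or> sgn (l i y') = sgn (c * l i (v k))"
        using cf i e by (auto simp: conformal_def linear_form_simps lin)
      moreover have "0 < c * l i (v k) \<or> c * l i (v k) < 0"
        using i(2) c(1) by (auto simp: mult_less_0_iff zero_less_mult_iff)
      ultimately have "0 < c * l i (v k) \<and> c' * l i (v k) \<le> c * l i (v k) \<or>
          c * l i (v k) < 0 \<and> c' * l i (v k) \<ge> c * l i (v k)"
        by (auto simp: sgn_if simp del: mult_eq_0_iff split: if_splits)
      then have "0 < l i (v k) \<and> c' * l i (v k) \<le> c * l i (v k) \<or>
          l i (v k) < 0 \<and> c' * l i (v k) \<ge> c * l i (v k)"
        using c(1) by (auto simp: mult_less_0_iff zero_less_mult_iff)
      then show ?thesis by (auto simp: mult_le_cancel_right)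
    qed
    obtain k c where p: "p = (k, c)" by force
    obtain k' c' where p': "p' = (k', c')" by force
    from Cons prems p p' have a: "admissible ((k, c) # s)" "admissible ((k', c') # q)"
      and e: "combination v ((k, c) # s) = combination v ((k', c') # q)" by auto
    from a e have "first_vertex (combination v ((k, c) # s)) k" "first_vertex (combination v ((k, c) # s)) k'"
      by auto
    then have kk: "k' = k" using first_vertex_unique by blast
    have e': "c *s v k + combination v s = c' *s v k + combination v q" using e kk by simp
    from a obtain i j where i: "i \<in> I" "l i (v k) \<noteq> 0" "l i (combination v s) = 0"
      and j: "j \<in> I" "l j (v k) \<noteq> 0" "l j (combination v q) = 0"
      using kk by auto
    have "c' \<le> c" by (rule bound[OF i _ _ e']) (use a kk in auto)
    moreover have "c \<le> c'" by (rule bound[OF j _ _ e'[symmetric]]) (use a kk in auto)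
    ultimately have "c = c'" by simp
    moreover from this e' have "combination v s = combination v q" by simp
    then have "s = q" using a IH by auto
    ultimately show ?thesis using Cons p p' kk by simp
  qed
qed

lemma conformal_summands:
  assumes c: "0 \<le> c" and u: "conformal I l u x" and y: "conformal I l y x"
  shows "conformal I l (c *s u + y) x"
  unfolding conformal_def
proof
  fix i assume i: "i \<in> I"
  have "c * l i u = 0 \<or> sgn (c * l i u) = sgn (l i x)"
    using c u i by (auto simp: conformal_def sgn_mult order_le_less)
  then have "c * l i u + l i y = 0 \<or> sgn (c * l i u + l i y) = sgn (l i x)"
    by (rule sgn_add_same) (use y i in \<open>auto simp: conformal_def\<close>)
  then show "l i (c *s u + y) = 0 \<or> sgn (l i (c *s u + y)) = sgn (l i x)"
    using i by (simp add: linear_form_simps lin)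
qed

text \<open>Two points of one closed face cannot cancel in any form, so both lie in the closed face
  of their sum.\<close>

lemma conformal_summand:
  assumes c: "0 < c" and u: "conformal I l u x" and y: "conformal I l y x"
  shows "conformal I l u (c *s u + y)" "conformal I l y (c *s u + y)"
proof -
  have *: "l i u \<noteq> 0 \<longrightarrow> sgn (c * l i u + l i y) = sgn (l i u)"
    "l i y \<noteq> 0 \<longrightarrow> sgn (c * l i u + l i y) = sgn (l i y)" if i: "i \<in> I" for i
  proof -
    have a: "l i u = 0 \<or> sgn (l i u) = sgn (l i x)" "l i y = 0 \<or> sgn (l i y) = sgn (l i x)"
      using u y i by (auto simp: conformal_def)
    then show 1: "l i u \<noteq> 0 \<longrightarrow> sgn (c * l i u + l i y) = sgn (l i u)"
      by (intro impI sgn_add_conformal[OF c]) auto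
    show "l i y \<noteq> 0 \<longrightarrow> sgn (c * l i u + l i y) = sgn (l i y)"
      using 1 a by (cases "l i u = 0") auto
  qed
  then show "conformal I l u (c *s u + y)" "conformal I l y (c *s u + y)"
    unfolding conformal_def by (simp_all add: linear_form_simps lin) metis+
qed

text \<open>Faces of a simplex of the pulling triangulation belong to it again. New coefficients,
  possibly zero, can only shrink the closed face, and an earlier vertex conformal to the new point
  would already be conformal to the old one. Hence each vertex that survives is still the
  first.\<close>

lemma admissible_restrict:
  assumes "admissible s" "map fst s' = map fst s" "\<forall>p\<in>set s'. 0 \<le> snd p"
  shows "admissible (filter (\<lambda>p. 0 < snd p) s') \<and> conformal I l (combination v s') (combination v s)"
  using assms
proof (induction s arbitrary: s')
  case Nil
  then show ?case by (simp add: conformal_def)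
next
  case (Cons p t)
  obtain k c where p: "p = (k, c)" by force
  obtain c' t' where s': "s' = (k, c') # t'" and t': "map fst t' = map fst t"
    using Cons.prems(2) p by (cases s') auto
  have c': "0 \<le> c'" and nn: "\<forall>p\<in>set t'. 0 \<le> snd p" using Cons.prems s' by auto
  let ?x = "c *s v k + combination v t" and ?x' = "c' *s v k + combination v t'"
  have adm: "0 < c" "admissible t" "first_vertex ?x k" "conformal I l (combination v t) ?x"
    using Cons.prems p by auto
  obtain i where i: "i \<in> I" "l i (v k) \<noteq> 0" "l i (combination v t) = 0"
    using Cons.prems p by auto
  have IH: "admissible (filter (\<lambda>p. 0 < snd p) t')"
    "conformal I l (combination v t') (combination v t)"
    using Cons.IH[OF adm(2) t' nn] by auto
  have vk: "conformal I l (v k) ?x" using adm by (simp add: first_vertex_def)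
  have t'x: "conformal I l (combination v t') ?x" using IH(2) adm(4) by (rule conformal_trans)
  have x'x: "conformal I l ?x' ?x" using c' vk t'x by (rule conformal_summands)
  show ?case
  proof (cases "c' = 0")
    case True
    then show ?thesis using s' IH x'x p by simp
  next
    case False
    then have c'0: "0 < c'" using c' by simp
    have "first_vertex ?x' k"
      using adm(3) conformal_summand(1)[OF c'0 vk t'x] conformal_trans[OF _ x'x]
      unfolding first_vertex_def by blast
    moreover have "conformal I l (combination v t') ?x'"
      using conformal_summand(2)[OF c'0 vk t'x] .
    moreover have "l i (combination v t') = 0"
      using IH(2) i by (auto simp: conformal_def sgn_0_0)
    ultimately show ?thesis
      using s' IH x'x p c'0 i nn by (auto simp: combination_filter_pos)
  qed
qed

definition expansion :: "'a ^ 'n \<Rightarrow> (nat \<times> 'a) list" where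
  "expansion x = (THE s. admissible s \<and> combination v s = x)"

lemma expansion: "admissible (expansion x)" "combination v (expansion x) = x"
proof -
  have "\<exists>!s. admissible s \<and> combination v s = x"
    using admissible_exists admissible_unique by metis
  from theI'[OF this] show "admissible (expansion x)" "combination v (expansion x) = x"
    unfolding expansion_def by auto
qed

lemma expansion_eqI: "admissible s \<Longrightarrow> combination v s = x \<Longrightarrow> expansion x = s"
  using admissible_unique expansion by metis

lemma admissible_indices: "admissible s \<Longrightarrow> p \<in> set s \<Longrightarrow> fst p < K"
  by (induction s) (auto simp: first_vertex_def)

text \<open>Each subtraction removes a form from the support. As a consequence only finitely many
  index lists, hence finitely many cones, occur.\<close>

lemma admissible_length: "admissible s \<Longrightarrow> length s \<le> card (support I l (combination v s))"
proof (induction s)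
  case (Cons p s)
  from Cons.prems obtain i where i: "i \<in> I" "l i (v (fst p)) \<noteq> 0" "l i (combination v s) = 0"
    and a: "conformal I l (combination v s) (combination v (p # s))" "0 < snd p" by auto
  have "l i (combination v (p # s)) \<noteq> 0" using i a by (simp add: linear_form_simps lin)
  then have "support I l (combination v s) \<subset> support I l (combination v (p # s))"
    using i a(1) by (intro support_psubset) auto
  then have "card (support I l (combination v s)) < card (support I l (combination v (p # s)))"
    using finite_support by (rule psubset_card_mono[rotated])
  then show ?case using Cons by simp
qed simp

lemma finite_admissible_indices: "finite {map fst s | s. admissible s}"
proof (rule finite_subset)
  show "{map fst s | s. admissible s} \<subseteq> {ks. set ks \<subseteq> {..<K} \<and> length ks \<le> card I}"
  proof clarify
    fix s assume s: "admissible s"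
    have "card (support I l (combination v s)) \<le> card I"
      using fin by (intro card_mono) (auto simp: support_def)
    then show "set (map fst s) \<subseteq> {..<K} \<and> length (map fst s) \<le> card I"
      using admissible_length[OF s] admissible_indices[OF s] by auto
  qed
qed (intro finite_lists_length_le finite_lessThan)

text \<open>
  The triangular shape of an admissible expansion makes the coefficients linear in the point.
\<close>

lemma admissible_cone:
  fixes v' :: "nat \<Rightarrow> 'a ^ 'm"
  assumes "admissible s"
  shows "\<exists>M T. finite M \<and> (\<forall>m\<in>M. linear_form m) \<and> linear_map T \<and>
    generated_cone v (map fst s) = {x. \<forall>m\<in>M. 0 \<le> m x} \<and>
    (\<forall>s'. map fst s' = map fst s \<and> (\<forall>p\<in>set s'. 0 \<le> snd p) \<longrightarrow>
      T (combination v s') = combination v' s')"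
  using assms
proof (induction s)
  case Nil
  let ?M = "l ` I \<union> (\<lambda>i x. - l i x) ` I"
  have "x = 0" if "\<forall>m\<in>?M. 0 \<le> m x" for x
  proof (rule essential)
    fix i assume "i \<in> I"
    then have "0 \<le> l i x" "0 \<le> - l i x"
      using bspec[OF that, of "l i"] bspec[OF that, of "\<lambda>x. - l i x"] by auto
    then show "l i x = 0" by simp
  qed
  moreover have "\<forall>m\<in>?M. 0 \<le> m 0" by (auto simp: linear_form_0 lin)
  ultimately have "x \<in> {x. \<forall>m\<in>?M. 0 \<le> m x} \<longleftrightarrow> x = 0" for x
    unfolding mem_Collect_eq by (intro iffI) (assumption | simp only:)+
  then have "{x. \<forall>m\<in>?M. 0 \<le> m x} = {0}" by (intro set_eqI) (simp only: singleton_iff)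
  moreover have "generated_cone v (map fst []) = {0}" by (auto simp: generated_cone_def)
  ultimately have "generated_cone v (map fst []) = {x. \<forall>m\<in>?M. 0 \<le> m x}"
    by (rule trans[OF _ sym, rotated])
  moreover have "finite ?M" using fin by simp
  moreover have "\<forall>m\<in>?M. linear_form m"
    using lin by (auto simp: linear_form_def)
  moreover have "linear_map (\<lambda>x :: 'a ^ 'n. 0 :: 'a ^ 'm)" by (simp add: linear_map_def)
  ultimately show ?case by (intro exI[of _ ?M] exI[of _ "\<lambda>x. 0"]) simp
next
  case (Cons p s)
  obtain k c where p: "p = (k, c)" by force
  have "admissible s" using Cons.prems by simp
  from Cons.IH[OF this] obtain M T where M: "finite M" "\<forall>m\<in>M. linear_form m" "linear_map T"
    "generated_cone v (map fst s) = {x. \<forall>m\<in>M. 0 \<le> m x}"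
    and T: "\<forall>s'. map fst s' = map fst s \<and> (\<forall>p\<in>set s'. 0 \<le> snd p) \<longrightarrow>
      T (combination v s') = combination v' s'"
    by (elim exE conjE) (rule that)
  from Cons.prems p obtain i where i: "i \<in> I" "l i (v k) \<noteq> 0" "l i (combination v s) = 0"
    by auto
  \<comment> \<open>\<open>l i\<close> vanishes at every nonnegative combination of the later
    vertices, because these lie in the closed face of \<open>combination v s\<close>. Hence its
    multiple \<open>m\<close> reads off the first coefficient, and \<open>P\<close> returns the
    tail, whose inequalities are then pulled back along \<open>P\<close>.\<close>
  define m where "m x = l i x / l i (v k)" for x
  define P where "P x = x - m x *s v k" for x
  have m: "linear_form m"
    using lin[OF i(1)] by (auto simp: m_def linear_form_def add_divide_distrib)
  have Padd: "P (x + y) = P x + P y" and Pscale: "P (d *s x) = d *s P x" for x y d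
    using m by (auto simp: P_def linear_form_def vec_eq_iff algebra_simps)
  have eval: "m (combination v ((k, d) # t)) = d" "P (combination v ((k, d) # t)) = combination v t"
    if t: "map fst t = map fst s" "\<forall>p\<in>set t. 0 \<le> snd p" for d t
  proof -
    have "conformal I l (combination v t) (combination v s)"
      using admissible_restrict[of s t] Cons.prems t by auto
    then have "l i (combination v t) = 0" using i by (auto simp: conformal_def sgn_0_0)
    then show "m (combination v ((k, d) # t)) = d"
      using i by (simp add: m_def linear_form_simps lin)
    then show "P (combination v ((k, d) # t)) = combination v t" by (simp add: P_def)
  qed
  let ?M = "insert m ((\<lambda>h. h \<circ> P) ` M)"
  let ?T = "\<lambda>x. m x *s v' k + T (P x)"
  have "generated_cone v (map fst (p # s)) = {x. \<forall>h\<in>?M. 0 \<le> h x}"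
  proof (intro equalityI subsetI)
    fix x assume "x \<in> generated_cone v (map fst (p # s))"
    then obtain s' where s': "x = combination v s'" "map fst s' = map fst (p # s)"
      "\<forall>p\<in>set s'. 0 \<le> snd p" unfolding generated_cone_def by blast
    then obtain d t where t: "s' = (k, d) # t" "map fst t = map fst s"
      using p by (cases s') auto
    then have nn: "\<forall>p\<in>set t. 0 \<le> snd p" "0 \<le> d" using s' by auto
    then have "combination v t \<in> generated_cone v (map fst s)"
      using t by (auto simp: generated_cone_def)
    then show "x \<in> {x. \<forall>h\<in>?M. 0 \<le> h x}"
      using eval[OF t(2) nn(1), of d] M(4) s'(1) t(1) nn by auto
  next
    fix x assume "x \<in> {x. \<forall>h\<in>?M. 0 \<le> h x}"
    then have x: "0 \<le> m x" "P x \<in> generated_cone v (map fst s)" using M(4) by auto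
    then obtain t where t: "P x = combination v t" "map fst t = map fst s"
      "\<forall>p\<in>set t. 0 \<le> snd p" unfolding generated_cone_def by blast
    have "x = m x *s v k + P x" by (simp add: P_def)
    then have "x = combination v ((k, m x) # t)" using t by simp
    moreover have "map fst ((k, m x) # t) = map fst (p # s)" "\<forall>p\<in>set ((k, m x) # t). 0 \<le> snd p"
      using t x p by auto
    ultimately show "x \<in> generated_cone v (map fst (p # s))"
      unfolding generated_cone_def by blast
  qed
  moreover have "finite ?M" using M by simp
  moreover have "\<forall>h\<in>?M. linear_form h"
    using m M(2) by (auto simp: linear_form_def Padd Pscale)
  moreover have "linear_map ?T"
    using M(3) m by (auto simp: linear_map_def linear_form_def Padd Pscale vec_eq_iff algebra_simps)
  moreover have "?T (combination v s') = combination v' s'"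
    if s': "map fst s' = map fst (p # s)" "\<forall>p\<in>set s'. 0 \<le> snd p" for s'
  proof -
    obtain d t where t: "s' = (k, d) # t" "map fst t = map fst s" using s' p by (cases s') auto
    moreover have "\<forall>p\<in>set t. 0 \<le> snd p" using s' t by auto
    ultimately show ?thesis using eval[of t d] T by simp
  qed
  ultimately show ?case by (intro exI[of _ ?M] exI[of _ ?T]) blast
qed

end

section \<open>Transferring expansions between two systems with equal vertex signs\<close>

lemma conformal_cong:
  assumes "\<And>i. i \<in> I \<Longrightarrow> sgn (l' i u') = sgn (l i u)" "\<And>i. i \<in> I \<Longrightarrow> sgn (l' i x') = sgn (l i x)"
  shows "conformal I l' u' x' \<longleftrightarrow> conformal I l u x"
  unfolding conformal_def using assms by (metis sgn_0_0)

locale vertex_system_pair =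
  A: vertex_system I l K v + B: vertex_system I l' K v'
  for I :: "'i set" and l :: "'i \<Rightarrow> 'a::linordered_field ^ 'n \<Rightarrow> 'a" and K v
    and l' :: "'i \<Rightarrow> 'a ^ 'm \<Rightarrow> 'a" and v' +
  assumes sgn_vertex: "\<And>k i. k < K \<Longrightarrow> i \<in> I \<Longrightarrow> sgn (l' i (v' k)) = sgn (l i (v k))"
begin

text \<open>Admissibility only speaks about sign vectors, and the sign vector of a sum of conformal
  summands is determined by those of the summands, since nothing cancels.\<close>

lemma admissible_transfer:
  "A.admissible s \<Longrightarrow>
    B.admissible s \<and> (\<forall>i\<in>I. sgn (l' i (combination v' s)) = sgn (l i (combination v s)))"
proof (induction s)
  case Nil
  then show ?case by (simp add: linear_form_0 A.lin B.lin)
next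
  case (Cons p s)
  obtain k c where p: "p = (k, c)" by force
  let ?y = "combination v s" and ?y' = "combination v' s"
  let ?x = "c *s v k + ?y" and ?x' = "c *s v' k + ?y'"
  have adm: "0 < c" "A.admissible s" "A.first_vertex ?x k" "conformal I l ?y ?x"
    using Cons.prems p by auto
  have kK: "k < K" and vk: "conformal I l (v k) ?x" using adm by (auto simp: A.first_vertex_def)
  have IH: "B.admissible s" "\<And>i. i \<in> I \<Longrightarrow> sgn (l' i ?y') = sgn (l i ?y)"
    using Cons.IH adm by auto
  have sx: "sgn (l' i ?x') = sgn (l i ?x)" if i: "i \<in> I" for i
  proof (cases "l i (v k) = 0")
    case True
    then have "l' i (v' k) = 0" using sgn_vertex[OF kK i] by (simp add: sgn_0_0)
    then show ?thesis using True IH(2)[OF i] i by (simp add: linear_form_simps A.lin B.lin)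
  next
    case False
    then have nz: "l' i (v' k) \<noteq> 0" using sgn_vertex[OF kK i] by (metis sgn_0_0)
    have s: "sgn (l i (v k)) = sgn (l i ?x)" "l i ?y = 0 \<or> sgn (l i ?y) = sgn (l i (v k))"
      using vk adm(4) i False unfolding conformal_def by metis+
    then have "l' i ?y' = 0 \<or> sgn (l' i ?y') = sgn (l' i (v' k))"
      using IH(2)[OF i] sgn_vertex[OF kK i] by (metis sgn_0_0)
    then have "sgn (c * l' i (v' k) + l' i ?y') = sgn (l' i (v' k))"
      by (rule sgn_add_conformal[OF adm(1) nz])
    then show ?thesis using s(1) sgn_vertex[OF kK i] i by (simp add: linear_form_simps B.lin)
  qed
  have "conformal I l' (v' j) ?x' \<longleftrightarrow> conformal I l (v j) ?x" if "j < K" for j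
    using that sgn_vertex sx by (intro conformal_cong) auto
  then have "B.first_vertex ?x' k"
    using adm(3) kK by (auto simp: A.first_vertex_def B.first_vertex_def)
  moreover have "conformal I l' ?y' ?x'"
    using adm(4) conformal_cong[of I l' ?y' l ?y ?x' ?x] IH(2) sx by blast
  moreover have "\<exists>i\<in>I. l' i (v' k) \<noteq> 0 \<and> l' i ?y' = 0"
    proof -
    obtain i where i: "i \<in> I" "l i (v k) \<noteq> 0" "l i ?y = 0" using Cons.prems p by auto
    then have "sgn (l' i (v' k)) \<noteq> 0" "sgn (l' i ?y') = 0"
      using IH(2) sgn_vertex[OF kK] by (simp_all add: sgn_0_0)
    then show ?thesis using i(1) by (auto simp: sgn_0_0)
  qed
  ultimately show ?case using adm IH p sx by auto
qed

definition conical_map :: "'a ^ 'n \<Rightarrow> 'a ^ 'm" where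
  "conical_map x = combination v' (A.expansion x)"

lemma sgn_conical_map: "i \<in> I \<Longrightarrow> sgn (l' i (conical_map x)) = sgn (l i x)"
  using admissible_transfer A.expansion unfolding conical_map_def by metis

text \<open>A zero coefficient contributes nothing on either side, so the formula for one index list
  persists on the boundary of its cone. This yields one linear map per closed cone.\<close>

lemma conical_map_combination:
  assumes "A.admissible s" "map fst s' = map fst s" "\<forall>p\<in>set s'. 0 \<le> snd p"
  shows "conical_map (combination v s') = combination v' s'"
proof -
  have "A.expansion (combination v s') = filter (\<lambda>p. 0 < snd p) s'"
    using A.admissible_restrict[OF assms] assms(3)
    by (intro A.expansion_eqI) (auto simp: combination_filter_pos)
  then show ?thesis using assms(3) by (simp add: conical_map_def combination_filter_pos)
qed

text \<open>Meant for the third coordinate: if partner vertices have equal heights,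
  \<open>conical_map\<close> preserves heights exactly and so acts on the plane of height 1.\<close>

lemma linear_form_conical_map:
  assumes "linear_form m" "linear_form m'" "\<And>k. k < K \<Longrightarrow> m' (v' k) = m (v k)"
  shows "m' (conical_map x) = m x"
proof -
  have "m' (combination v' (A.expansion x)) = m (combination v (A.expansion x))"
    by (rule linear_form_combination_eq[OF assms(2,1)])
      (intro assms(3) A.admissible_indices[OF A.expansion(1)])
  then show ?thesis by (simp add: conical_map_def A.expansion)
qed

lemma conical_map_piecewise:
  "\<exists>\<Q>. finite \<Q> \<and> \<Union>\<Q> = UNIV \<and>
     (\<forall>Q\<in>\<Q>. polyhedral_cone Q \<and> (\<exists>T. linear_map T \<and> (\<forall>x\<in>Q. conical_map x = T x)))"
proof -
  let ?\<Q> = "generated_cone v ` {map fst s | s. A.admissible s}"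
  have "x \<in> \<Union>?\<Q>" for x
  proof -
    have "\<forall>p\<in>set s. 0 \<le> snd p" if "A.admissible s" for s
      using that by (induction s) auto
    then have "x \<in> generated_cone v (map fst (A.expansion x))"
      using A.expansion[of x] unfolding generated_cone_def
      by (intro CollectI exI[of _ "A.expansion x"]) auto
    moreover have "map fst (A.expansion x) \<in> {map fst s | s. A.admissible s}"
      using A.expansion(1) by blast
    ultimately show ?thesis by (rule UnionI[OF imageI, rotated])
  qed
  then have cover: "\<Union>?\<Q> = UNIV" by (intro equalityI subsetI UNIV_I)
  have piece: "polyhedral_cone Q \<and> (\<exists>T. linear_map T \<and> (\<forall>x\<in>Q. conical_map x = T x))"
    if Q: "Q \<in> ?\<Q>" for Q
  proof -
    obtain s where s: "A.admissible s" "Q = generated_cone v (map fst s)" using Q by auto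
    obtain M T where M: "finite M" "\<forall>m\<in>M. linear_form m" "linear_map T"
      "generated_cone v (map fst s) = {x. \<forall>m\<in>M. 0 \<le> m x}"
      and T: "\<forall>s'. map fst s' = map fst s \<and> (\<forall>p\<in>set s'. 0 \<le> snd p) \<longrightarrow>
        T (combination v s') = combination v' s'"
      using A.admissible_cone[OF s(1), of v'] by (elim exE conjE) (rule that)
    have "conical_map x = T x" if "x \<in> Q" for x
      using that s T conical_map_combination[OF s(1)] by (auto simp: generated_cone_def)
    moreover have "polyhedral_cone Q" unfolding polyhedral_cone_def s(2) using M(1,2,4) by blast
    ultimately show ?thesis using M(3) by blast
  qed
  have finite: "finite ?\<Q>" using A.finite_admissible_indices by (rule finite_imageI)
  show ?thesis
    by (rule exI[of _ ?\<Q>]) (intro conjI ballI finite cover piece[THEN conjunct1] piece[THEN conjunct2])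
qed

lemma swap: "vertex_system_pair I l' K v' l v"
  by unfold_locales (simp add: sgn_vertex)

text \<open>The list expanding \<open>x\<close> is admissible in the second system too, so there it
  is the expansion of the image.\<close>

lemma conical_map_inverse:
  "vertex_system_pair.conical_map I l' K v' v (conical_map x) = x"
proof -
  interpret C: vertex_system_pair I l' K v' l v by (rule swap)
  have "B.expansion (conical_map x) = A.expansion x"
    using admissible_transfer[OF A.expansion(1)]
    by (intro B.expansion_eqI) (auto simp: conical_map_def)
  then show ?thesis by (simp add: C.conical_map_def A.expansion)
qed

end

section \<open>Piecewise linear maps of the plane\<close>

definition dot3 :: "'a::field ^ 3 \<Rightarrow> 'a ^ 3 \<Rightarrow> 'a" where
  "dot3 a x = a $ 1 * x $ 1 + a $ 2 * x $ 2 + a $ 3 * x $ 3"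

definition homogenize :: "'a::field ^ 2 \<Rightarrow> 'a ^ 3" where
  "homogenize x = vector [x $ 1, x $ 2, 1]"

definition plane_coordinates :: "'a::field ^ 3 \<Rightarrow> 'a ^ 2" where
  "plane_coordinates x = vector [x $ 1, x $ 2]"

lemma homogenize_nth [simp]:
  "homogenize x $ 1 = x $ 1" "homogenize x $ 2 = x $ 2" "homogenize x $ 3 = 1"
  by (simp_all add: homogenize_def)

lemma plane_coordinates_nth [simp]:
  "plane_coordinates x $ 1 = x $ 1" "plane_coordinates x $ 2 = x $ 2"
  by (simp_all add: plane_coordinates_def)

lemma vec_eq_2: "(x :: 'a ^ 2) = y \<longleftrightarrow> x $ 1 = y $ 1 \<and> x $ 2 = y $ 2"
  by (simp add: vec_eq_iff forall_2)

lemma vec_eq_3: "(x :: 'a ^ 3) = y \<longleftrightarrow> x $ 1 = y $ 1 \<and> x $ 2 = y $ 2 \<and> x $ 3 = y $ 3"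
  by (simp add: vec_eq_iff forall_3)

lemma plane_coordinates_homogenize [simp]: "plane_coordinates (homogenize x) = x"
  by (simp add: vec_eq_2)

lemma homogenize_plane_coordinates: "x $ 3 = 1 \<Longrightarrow> homogenize (plane_coordinates x) = x"
  by (simp add: vec_eq_3)

lemma linear_form_dot3: "linear_form (dot3 a)"
  by (simp add: linear_form_def dot3_def algebra_simps)

lemma linear_form_nth: "linear_form (\<lambda>x. x $ i)"
  by (simp add: linear_form_def)

lemma linear_form_eq_dot3:
  assumes "linear_form m"
  shows "m = dot3 (vector [m (axis 1 1), m (axis 2 1), m (axis 3 1)])"
proof
  fix x :: "'a ^ 3"
  have "x = x $ 1 *s axis 1 1 + x $ 2 *s axis 2 1 + x $ 3 *s axis 3 1"
    by (simp add: vec_eq_3 axis_def)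
  then have "m x = m (x $ 1 *s axis 1 1 + x $ 2 *s axis 2 1 + x $ 3 *s axis 3 1)" by simp
  then show "m x = dot3 (vector [m (axis 1 1), m (axis 2 1), m (axis 3 1)]) x"
    by (simp add: linear_form_simps assms dot3_def mult.commute)
qed

lemma linear_map_affine_on:
  assumes T: "linear_map T" and f: "\<And>x. x \<in> P \<Longrightarrow> f x = plane_coordinates (T (homogenize x))"
  shows "affine_on P f"
proof -
  let ?e1 = "T (axis 1 1)" and ?e2 = "T (axis 2 1)" and ?e3 = "T (axis 3 1)"
  have "f x = vector [vector [?e1 $ 1, ?e2 $ 1], vector [?e1 $ 2, ?e2 $ 2]] *v x + vector [?e3 $ 1, ?e3 $ 2]"
    if "x \<in> P" for x
  proof -
    have "homogenize x = x $ 1 *s axis 1 1 + x $ 2 *s axis 2 1 + axis 3 1"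
      by (simp add: vec_eq_3 axis_def)
    then have "T (homogenize x) = x $ 1 *s ?e1 + x $ 2 *s ?e2 + ?e3"
      using T by (simp add: linear_map_def)
    then show ?thesis using f[OF that]
      by (simp add: vec_eq_2 matrix_vector_mult_def sum_2 mult.commute)
  qed
  then show ?thesis unfolding affine_on_def by blast
qed

section \<open>Lines, half-planes and polygonal decompositions\<close>

abbreviation (input) aff :: "'a::field ^ 3 \<Rightarrow> 'a ^ 2 \<Rightarrow> 'a" where
  "aff a x \<equiv> dot3 a (homogenize x)"

lemma aff_eq: "aff a x = a $ 1 * x $ 1 + a $ 2 * x $ 2 + a $ 3"
  by (simp add: dot3_def)

lemma zero_set_eq_line_through:
  fixes a :: "'a::linordered_field ^ 3"
  assumes a: "a $ 1 \<noteq> 0 \<or> a $ 2 \<noteq> 0" and p: "aff a p = 0"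
    and w: "w \<noteq> 0" "a $ 1 * w $ 1 + a $ 2 * w $ 2 = 0"
  shows "{x. aff a x = 0} = line_through p w"
proof (intro equalityI subsetI)
  fix x assume "x \<in> {x. aff a x = 0}"
  then have "a $ 1 * x $ 1 + a $ 2 * x $ 2 = a $ 1 * p $ 1 + a $ 2 * p $ 2"
    using p by (simp add: aff_eq)
  then have e: "a $ 1 * (x $ 1 - p $ 1) = - (a $ 2 * (x $ 2 - p $ 2))" by (simp add: algebra_simps)
  have f: "a $ 1 * w $ 1 = - (a $ 2 * w $ 2)" using w(2) by (simp add: add_eq_0_iff2)
  have det: "(x $ 1 - p $ 1) * w $ 2 = (x $ 2 - p $ 2) * w $ 1"
  proof (cases "a $ 1 = 0")
    case True
    then have "w $ 2 = 0" "x $ 2 - p $ 2 = 0" using a e f by auto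
    then show ?thesis by simp
  next
    case False
    have "a $ 1 * ((x $ 1 - p $ 1) * w $ 2) = - (a $ 2 * (x $ 2 - p $ 2)) * w $ 2"
      using e by (simp flip: mult.assoc)
    also have "\<dots> = (a $ 1 * w $ 1) * (x $ 2 - p $ 2)" unfolding f by (simp add: mult_ac)
    finally have "a $ 1 * ((x $ 1 - p $ 1) * w $ 2) = a $ 1 * ((x $ 2 - p $ 2) * w $ 1)"
      by (simp add: mult_ac)
    then show ?thesis using False by simp
  qed
  have "\<exists>t. x = p + t *s w"
  proof (cases "w $ 1 = 0")
    case True
    then have "w $ 2 \<noteq> 0" using w(1) by (auto simp: vec_eq_2)
    then show ?thesis using det True
      by (intro exI[of _ "(x $ 2 - p $ 2) / w $ 2"]) (auto simp: vec_eq_2)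
  next
    case False
    then have "(x $ 1 - p $ 1) * w $ 2 / w $ 1 = x $ 2 - p $ 2" using det by simp
    then show ?thesis using False
      by (intro exI[of _ "(x $ 1 - p $ 1) / w $ 1"]) (simp add: vec_eq_2)
  qed
  then show "x \<in> line_through p w" by (auto simp: line_through_def)
next
  fix x assume "x \<in> line_through p w"
  then obtain t where "x = p + t *s w" by (auto simp: line_through_def)
  then have "aff a x = aff a p + t * (a $ 1 * w $ 1 + a $ 2 * w $ 2)"
    by (simp add: aff_eq algebra_simps)
  then show "x \<in> {x. aff a x = 0}" using p w(2) by simp
qed

lemma is_line_zero_set:
  fixes a :: "'a::linordered_field ^ 3"
  assumes a: "a $ 1 \<noteq> 0 \<or> a $ 2 \<noteq> 0"
  shows "is_line {x. aff a x = 0}"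
proof -
  let ?p = "(if a $ 1 = 0 then vector [0, - a $ 3 / a $ 2] else vector [- a $ 3 / a $ 1, 0]) :: 'a ^ 2"
  let ?w = "vector [- a $ 2, a $ 1] :: 'a ^ 2"
  have "aff a ?p = 0" using a by (simp add: aff_eq)
  moreover have "?w \<noteq> 0" using a by (auto simp: vec_eq_2)
  ultimately have "{x. aff a x = 0} = line_through ?p ?w"
    using a by (intro zero_set_eq_line_through) simp_all
  then show ?thesis using \<open>?w \<noteq> 0\<close> unfolding is_line_def by blast
qed

lemma closed_half_plane_aff:
  fixes a :: "'a::linordered_field ^ 3"
  assumes "a $ 1 \<noteq> 0 \<or> a $ 2 \<noteq> 0"
  shows "closed_half_plane {x. 0 \<le> aff a x}" "closed_half_plane {x. aff a x \<le> 0}"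
proof -
  let ?b = "vector [- a $ 1, - a $ 2] :: 'a ^ 2" and ?c = "vector [a $ 1, a $ 2] :: 'a ^ 2"
  have "{x. 0 \<le> aff a x} = {x. ?b $ 1 * x $ 1 + ?b $ 2 * x $ 2 \<le> a $ 3}"
    by (auto simp: aff_eq algebra_simps)
  moreover have "?b \<noteq> 0" using assms by (simp add: vec_eq_2)
  ultimately show "closed_half_plane {x. 0 \<le> aff a x}"
    unfolding closed_half_plane_def by blast
  have "{x. aff a x \<le> 0} = {x. ?c $ 1 * x $ 1 + ?c $ 2 * x $ 2 \<le> - a $ 3}"
    by (auto simp: aff_eq algebra_simps)
  moreover have "?c \<noteq> 0" using assms by (simp add: vec_eq_2)
  ultimately show "closed_half_plane {x. aff a x \<le> 0}"
    unfolding closed_half_plane_def by blast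
qed

text \<open>Stands in for the topological fact that finitely many open conditions have a common
  neighbourhood: the least of the bounds serves all.\<close>

lemma common_small_step:
  assumes "finite N"
    and "\<And>a. a \<in> N \<Longrightarrow> \<exists>d>0. \<forall>e. 0 < e \<and> e \<le> d \<longrightarrow> P a (e :: 'a::linordered_field)"
  shows "\<exists>d>0. \<forall>a\<in>N. \<forall>e. 0 < e \<and> e \<le> d \<longrightarrow> P a e"
  using assms
proof (induction N rule: finite_induct)
  case empty
  show ?case by (intro exI[of _ 1]) simp
next
  case (insert b N)
  from insert.prems[of b] obtain d where d: "d > 0" "\<forall>e. 0 < e \<and> e \<le> d \<longrightarrow> P b e" by auto
  have "\<exists>d>0. \<forall>a\<in>N. \<forall>e. 0 < e \<and> e \<le> d \<longrightarrow> P a e"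
    by (rule insert.IH, rule insert.prems) simp
  then obtain d' where
    d': "d' > 0" "\<forall>a\<in>N. \<forall>e. 0 < e \<and> e \<le> d' \<longrightarrow> P a e" by blast
  show ?case using d d' by (intro exI[of _ "min d d'"]) auto
qed

lemma small_perturbation_pos:
  fixes a b :: "'a::linordered_field"
  assumes "0 < a"
  shows "\<exists>d>0. \<forall>e. 0 < e \<and> e \<le> d \<longrightarrow> 0 < a + e * b"
proof (cases "0 \<le> b")
  case True
  then show ?thesis using assms by (intro exI[of _ 1]) (auto intro: add_pos_nonneg)
next
  case False
  define c where "c = - b"
  have c: "0 < c" "b = - c" using False by (auto simp: c_def)
  have "0 < a + e * b" if "0 < e" "e \<le> a / (2 * c)" for e
  proof -
    have "e * (2 * c) \<le> a" using that c(1) by (simp add: pos_le_divide_eq)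
    then have "2 * (e * c) \<le> a" by (simp add: algebra_simps)
    then have "e * c < a" using assms by linarith
    then show ?thesis by (simp add: c(2))
  qed
  moreover have "0 < a / (2 * c)" using assms c(1) by simp
  ultimately show ?thesis by blast
qed

text \<open>
  Every finite cover by pieces cut out by affine inequalities is refined by the two-dimensional
  closed cells of the arrangement of all the bounding lines.
\<close>

lemma polygonal_decomposition_refinement:
  fixes S :: "'q \<Rightarrow> ('a::linordered_field ^ 3) set"
  assumes fin: "finite \<Q>" "\<And>q. q \<in> \<Q> \<Longrightarrow> finite (S q)"
    and cover: "\<And>x. \<exists>q\<in>\<Q>. \<forall>a\<in>S q. 0 \<le> aff a x"
  shows "\<exists>\<D>. polygonal_decomposition \<D> \<and> (\<forall>P\<in>\<D>. \<exists>q\<in>\<Q>. \<forall>x\<in>P. \<forall>a\<in>S q. 0 \<le> aff a x)"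
proof -
  \<comment> \<open>Constant affine forms bound no half-plane and are left out; their sign is the
    same everywhere.\<close>
  define N where "N = {a \<in> \<Union>(S ` \<Q>). a $ 1 \<noteq> 0 \<or> a $ 2 \<noteq> 0}"
  have finN: "finite N" using fin by (simp add: N_def)
  define C where "C T = {x. (\<forall>a\<in>T. 0 \<le> aff a x) \<and> (\<forall>a\<in>N - T. aff a x \<le> 0)}" for T
  define O' where "O' T = {x. (\<forall>a\<in>T. 0 < aff a x) \<and> (\<forall>a\<in>N - T. aff a x < 0)}" for T
  \<comment> \<open>Only sign patterns attained strictly at some point are kept: these give the
    two-dimensional cells, and the strict point later selects the piece that contains the
    cell.\<close>
  define \<D> where "\<D> = C ` {T. T \<subseteq> N \<and> O' T \<noteq> {}}"
  have finite: "finite \<D>" using finN by (auto simp: \<D>_def)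
  have convex: "convex_polygonal P" if P: "P \<in> \<D>" for P
  proof -
    obtain T where T: "T \<subseteq> N" "P = C T" using P unfolding \<D>_def by blast
    let ?H = "(\<lambda>a. {x. 0 \<le> aff a x}) ` T \<union> (\<lambda>a. {x. aff a x \<le> 0}) ` (N - T)"
    have "finite ?H" using finN T finite_subset by auto
    moreover have "\<forall>H\<in>?H. closed_half_plane H"
      using closed_half_plane_aff T by (auto simp: N_def)
    moreover have "P = \<Inter>?H" using T by (auto simp: C_def)
    ultimately show ?thesis unfolding convex_polygonal_def by blast
  qed
  have meet: "\<exists>L. is_line L \<and> P \<inter> Q \<subseteq> L" if PQ: "P \<in> \<D>" "Q \<in> \<D>" "P \<noteq> Q" for P Q
  proof -
    obtain T U where T: "T \<subseteq> N" "P = C T" and U: "U \<subseteq> N" "Q = C U"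
      using PQ unfolding \<D>_def by blast
    then have "T \<noteq> U" using PQ by auto
    then obtain a where a: "a \<in> T \<and> a \<in> N - U \<or> a \<in> U \<and> a \<in> N - T" using T U by blast
    then have "P \<inter> Q \<subseteq> {x. aff a x = 0}" using T U by (auto simp: C_def intro: order.antisym)
    moreover have "is_line {x. aff a x = 0}"
      by (rule is_line_zero_set) (use a in \<open>auto simp: N_def\<close>)
    ultimately show ?thesis by blast
  qed
  have "x \<in> \<Union>\<D>" for x
  proof -
    \<comment> \<open>The direction (1, s) shall be parallel to none of the finitely many lines;
      this is possible because an ordered field is infinite.\<close>
    obtain s where s: "s \<notin> (\<lambda>a. - a $ 1 / a $ 2) ` N"
      using ex_new_if_finite[OF infinite_UNIV_char_0 finite_imageI[OF finN]] by blast
    define w :: "'a ^ 2" where "w = vector [1, s]"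
    define b where "b a = a $ 1 * w $ 1 + a $ 2 * w $ 2" for a :: "'a ^ 3"
    have b0: "b a \<noteq> 0" if "a \<in> N" for a
    proof
      assume "b a = 0"
      then have e: "a $ 1 + a $ 2 * s = 0" by (simp add: b_def w_def)
      then have "a $ 2 \<noteq> 0" using that by (auto simp: N_def)
      moreover have "s * a $ 2 = - a $ 1" using e by (simp add: add_eq_0_iff mult.commute)
      ultimately have "s = - a $ 1 / a $ 2" by (subst nonzero_eq_divide_eq)
      then show False using s that by blast
    qed
    have shift: "aff a (x + e *s w) = aff a x + e * b a" for a e
      by (simp add: aff_eq b_def algebra_simps)
    \<comment> \<open>The sign pattern just after leaving \<open>x\<close> along \<open>w\<close>:
      on a line through \<open>x\<close> the slope \<open>b a\<close> decides.\<close>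
    define T where "T = {a\<in>N. 0 < aff a x \<or> aff a x = 0 \<and> 0 < b a}"
    have step: "\<exists>d>0. \<forall>e. 0 < e \<and> e \<le> d \<longrightarrow>
      (a \<in> T \<longrightarrow> 0 < aff a (x + e *s w)) \<and> (a \<notin> T \<longrightarrow> aff a (x + e *s w) < 0)"
      if a: "a \<in> N" for a
    proof -
      consider "0 < aff a x" | "aff a x = 0" | "0 < - aff a x"
        by (cases "aff a x" "0 :: 'a" rule: linorder_cases) simp_all
      then show ?thesis
      proof cases
        case 1
        then have "a \<in> T" using a by (simp add: T_def)
        then show ?thesis using small_perturbation_pos[OF 1, of "b a"] by (simp add: shift)
      next
        case 2
        then show ?thesis using a b0[OF a]
          by (intro exI[of _ 1]) (auto simp: T_def shift mult_pos_neg mult_pos_pos)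
      next
        case 3
        then have "a \<notin> T" by (simp add: T_def)
        moreover have "\<exists>d>0. \<forall>e. 0 < e \<and> e \<le> d \<longrightarrow> aff a x + e * b a < 0"
        proof -
          obtain d where d: "d > 0" "\<forall>e. 0 < e \<and> e \<le> d \<longrightarrow> 0 < - aff a x + e * - b a"
            using small_perturbation_pos[OF 3, of "- b a"] by blast
          have "aff a x + e * b a < 0" if "0 < e" "e \<le> d" for e
          proof -
            have "0 < - aff a x + e * - b a" using d that by blast
            then show ?thesis by (simp add: algebra_simps)
          qed
          then show ?thesis using d by blast
        qed
        ultimately show ?thesis by (simp add: shift)
      qed
    qed
    have "\<exists>d>0. \<forall>a\<in>N. \<forall>e. 0 < e \<and> e \<le> d \<longrightarrow>
      (a \<in> T \<longrightarrow> 0 < aff a (x + e *s w)) \<and> (a \<notin> T \<longrightarrow> aff a (x + e *s w) < 0)"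
      by (rule common_small_step[OF finN step])
    then obtain d where "d > 0"
      "\<forall>a\<in>N. (a \<in> T \<longrightarrow> 0 < aff a (x + d *s w)) \<and> (a \<notin> T \<longrightarrow> aff a (x + d *s w) < 0)"
      by blast
    then have "x + d *s w \<in> O' T" "T \<subseteq> N" by (auto simp: O'_def T_def)
    moreover have "x \<in> C T" by (auto simp: C_def T_def)
    ultimately show ?thesis unfolding \<D>_def by blast
  qed
  then have "\<Union>\<D> = UNIV" by blast
  then have dec: "polygonal_decomposition \<D>"
    using finite convex meet unfolding polygonal_decomposition_def by simp
  have refine: "\<exists>q\<in>\<Q>. \<forall>x\<in>P. \<forall>a\<in>S q. 0 \<le> aff a x" if P: "P \<in> \<D>" for P
  proof -
    obtain T y where T: "T \<subseteq> N" "P = C T" "y \<in> O' T" using P unfolding \<D>_def by blast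
    \<comment> \<open>A piece containing the strict point \<open>y\<close> has its nonconstant forms
      positive there, so they belong to \<open>T\<close> and are nonnegative on the whole
      cell.\<close>
    obtain q where q: "q \<in> \<Q>" "\<forall>a\<in>S q. 0 \<le> aff a y" using cover by blast
    have "0 \<le> aff a x" if x: "x \<in> P" "a \<in> S q" for x a
    proof (cases "a \<in> N")
      case True
      then have "a \<in> T" using T(3) q x by (force simp: O'_def)
      then show ?thesis using x T by (auto simp: C_def)
    next
      case False
      then have "a $ 1 = 0" "a $ 2 = 0" using x q by (auto simp: N_def)
      then have "aff a x = aff a y" by (simp add: aff_eq)
      then show ?thesis using q x by simp
    qed
    then show ?thesis using q by blast
  qed
  show ?thesis by (rule exI[of _ \<D>]) (intro conjI ballI dec refine)
qed

theorem piecewise_linear_automorphism_of_vertex_systems: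
  fixes l l' :: "'i \<Rightarrow> 'a::linordered_field ^ 3 \<Rightarrow> 'a"
  assumes "vertex_system_pair I l K v l' v'" and z: "\<And>k. k < K \<Longrightarrow> v' k $ 3 = v k $ 3"
  shows "\<exists>f. piecewise_linear_automorphism f \<and>
    (\<forall>i\<in>I. f ` {x. l i (homogenize x) = 0} = {x. l' i (homogenize x) = 0})"
proof -
  interpret A: vertex_system_pair I l K v l' v' by fact
  interpret B: vertex_system_pair I l' K v' l v by (rule A.swap)
  define f where "f x = plane_coordinates (A.conical_map (homogenize x))" for x
  define g where "g x = plane_coordinates (B.conical_map (homogenize x))" for x
  have hf: "homogenize (f x) = A.conical_map (homogenize x)" for x
    unfolding f_def using A.linear_form_conical_map[OF linear_form_nth linear_form_nth z]
    by (intro homogenize_plane_coordinates) simp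
  have hg: "homogenize (g x) = B.conical_map (homogenize x)" for x
    unfolding g_def using B.linear_form_conical_map[OF linear_form_nth linear_form_nth z[symmetric]]
    by (intro homogenize_plane_coordinates) simp
  have gf: "g (f x) = x" for x
    by (simp add: g_def hf A.conical_map_inverse)
  have fg: "f (g x) = x" for x
    by (simp add: f_def hg B.conical_map_inverse)
  have "bij f" using gf fg by (intro o_bij[of g]) (auto simp: fun_eq_iff)
  obtain \<Q> where Q: "finite \<Q>" "\<Union>\<Q> = UNIV"
    "\<forall>Q\<in>\<Q>. polyhedral_cone Q \<and> (\<exists>T. linear_map T \<and> (\<forall>x\<in>Q. A.conical_map x = T x))"
    using A.conical_map_piecewise by blast
  have "\<forall>Q\<in>\<Q>. \<exists>S. finite S \<and> Q = {x. \<forall>a\<in>S. 0 \<le> dot3 a x}"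
  proof
    fix Q assume "Q \<in> \<Q>"
    then have "polyhedral_cone Q" using Q(3) by blast
    then obtain M where M: "finite M" "\<forall>m\<in>M. linear_form m" "Q = {x. \<forall>m\<in>M. 0 \<le> m x}"
      unfolding polyhedral_cone_def by blast
    let ?r = "\<lambda>m. vector [m (axis 1 1), m (axis 2 1), m (axis 3 1)]"
    have "dot3 (?r m) x = m x" if "m \<in> M" for m x
      by (rule fun_cong[OF linear_form_eq_dot3[symmetric]]) (use M(2) that in blast)
    then have "Q = {x. \<forall>a\<in>?r ` M. 0 \<le> dot3 a x}" using M(3) by simp
    then show "\<exists>S. finite S \<and> Q = {x. \<forall>a\<in>S. 0 \<le> dot3 a x}" using M(1) by blast
  qed
  from bchoice[OF this] obtain S where
    "\<forall>Q\<in>\<Q>. finite (S Q) \<and> Q = {x. \<forall>a\<in>S Q. 0 \<le> dot3 a x}" by (elim exE) (rule that)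
  then have S: "finite (S Q)" "x \<in> Q \<longleftrightarrow> (\<forall>a\<in>S Q. 0 \<le> dot3 a x)" if "Q \<in> \<Q>" for Q x
    using that by blast+
  have "\<exists>q\<in>\<Q>. \<forall>a\<in>S q. 0 \<le> aff a x" for x
  proof -
    obtain q where "q \<in> \<Q>" "homogenize x \<in> q" using Q(2) by blast
    then show ?thesis using S(2) by (intro bexI[of _ q]) simp_all
  qed
  from polygonal_decomposition_refinement[OF Q(1) S(1) this] obtain \<D> where
    D: "polygonal_decomposition \<D>" "\<forall>P\<in>\<D>. \<exists>q\<in>\<Q>. \<forall>x\<in>P. \<forall>a\<in>S q. 0 \<le> aff a x" by blast
  have "affine_on P f" if P: "P \<in> \<D>" for P
  proof -
    obtain q where q: "q \<in> \<Q>" "\<forall>x\<in>P. \<forall>a\<in>S q. 0 \<le> aff a x" using D(2) P by blast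
    then have "\<forall>x\<in>P. homogenize x \<in> q" using S(2) by simp
    moreover obtain T where T: "linear_map T" "\<forall>x\<in>q. A.conical_map x = T x" using Q(3) q by blast
    ultimately show ?thesis by (intro linear_map_affine_on[OF T(1)]) (simp add: f_def)
  qed
  then have "piecewise_linear_automorphism f"
    using \<open>bij f\<close> D(1) unfolding piecewise_linear_automorphism_def by blast
  moreover have "f ` {x. l i (homogenize x) = 0} = {x. l' i (homogenize x) = 0}" if "i \<in> I" for i
  proof -
    have "l' i (homogenize (f x)) = 0 \<longleftrightarrow> l i (homogenize x) = 0" for x
      using A.sgn_conical_map[OF that] by (metis hf sgn_0_0)
    then show ?thesis using fg by (auto simp: image_iff) metis
  qed
  ultimately show ?thesis by blast
qed

section \<open>Arrangements with the same orientations\<close>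

text \<open>For two lines in homogeneous coordinates this spans the ray over their point of
  intersection; \<open>triple_prod\<close> is the determinant with rows a, b, c.\<close>

definition cross_prod :: "'a::field ^ 3 \<Rightarrow> 'a ^ 3 \<Rightarrow> 'a ^ 3" where
  "cross_prod a b = vector [a $ 2 * b $ 3 - a $ 3 * b $ 2, a $ 3 * b $ 1 - a $ 1 * b $ 3,
     a $ 1 * b $ 2 - a $ 2 * b $ 1]"

definition triple_prod :: "'a::field ^ 3 \<Rightarrow> 'a ^ 3 \<Rightarrow> 'a ^ 3 \<Rightarrow> 'a" where
  "triple_prod a b c = dot3 c (cross_prod a b)"

lemmas vector3_simps = cross_prod_def triple_prod_def dot3_def algebra_simps

lemma triple_prod_rotate: "triple_prod b c a = triple_prod a b c"
  by (simp add: vector3_simps)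

lemma triple_prod_swap: "triple_prod b a c = - triple_prod a b c"
  by (simp add: vector3_simps)

lemma triple_prod_swap': "triple_prod a c b = - triple_prod a b c"
  by (simp add: vector3_simps)

lemma triple_prod_degenerate [simp]:
  "triple_prod a a b = 0" "triple_prod a b a = 0" "triple_prod b a a = 0"
  by (simp_all add: vector3_simps)

lemma dot3_scale [simp]: "dot3 a (c *s x) = c * dot3 a x"
  by (rule linear_form_scale[OF linear_form_dot3])

text \<open>Cramer's rule: the identity in the proof holds for all \<open>x\<close> and expands it
  in the dual basis, up to the determinant.\<close>

lemma cramer3:
  assumes "dot3 a x = 0" "dot3 b x = 0"
  shows "triple_prod a b c *s x = dot3 c x *s cross_prod a b"
proof -
  have "triple_prod a b c *s x =
    dot3 a x *s cross_prod b c + dot3 b x *s cross_prod c a + dot3 c x *s cross_prod a b"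
    by (simp add: vec_eq_3 vector3_simps)
  then show ?thesis using assms by (simp add: vec_eq_3)
qed

lemma triple_prod_essential:
  assumes "triple_prod a b c \<noteq> 0" "dot3 a x = 0" "dot3 b x = 0" "dot3 c x = 0"
  shows "x = 0"
  using cramer3[OF assms(2,3), of c] assms(1,4) by (simp add: vec_eq_3)

definition generic_position :: "'i set \<Rightarrow> ('i \<Rightarrow> 'a::linordered_field ^ 3) \<Rightarrow> bool" where
  "generic_position I a \<longleftrightarrow> (\<forall>i\<in>I. \<forall>j\<in>I. \<forall>k\<in>I. i \<noteq> j \<and> i \<noteq> k \<and> j \<noteq> k \<longrightarrow>
     triple_prod (a i) (a j) (a k) \<noteq> 0)"

lemma generic_positionD:
  "generic_position I a \<Longrightarrow> i \<in> I \<Longrightarrow> j \<in> I \<Longrightarrow> k \<in> I \<Longrightarrow> i \<noteq> j \<Longrightarrow> i \<noteq> k \<Longrightarrow> j \<noteq> k \<Longrightarrow>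
    triple_prod (a i) (a j) (a k) \<noteq> 0"
  by (simp add: generic_position_def)

lemma exists_third:
  assumes "3 \<le> card I"
  shows "\<exists>k\<in>I. k \<noteq> i \<and> k \<noteq> j"
proof (rule ccontr)
  assume "\<not> ?thesis"
  then have "I \<subseteq> {i, j}" by blast
  then have "card I \<le> card {i, j}" by (intro card_mono) auto
  also have "\<dots> \<le> 2" by (simp add: card_insert_if)
  finally show False using assms by simp
qed

text \<open>Descend to smaller faces until two forms vanish; the point is then a multiple of their
  cross product, so it spans an extreme ray.\<close>

lemma exists_conformal_cross_prod:
  fixes a :: "'i \<Rightarrow> 'a::linordered_field ^ 3"
  assumes fin: "finite I" and card: "3 \<le> card I" and gen: "generic_position I a"
  shows "x \<noteq> 0 \<Longrightarrow> \<exists>i\<in>I. \<exists>j\<in>I. i \<noteq> j \<and> (\<exists>s\<in>{1, -1}.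
    conformal I (\<lambda>i. dot3 (a i)) (s *s cross_prod (a i) (a j)) x)"
proof (induction "card (support I (\<lambda>i. dot3 (a i)) x)" arbitrary: x rule: less_induct)
  case less
  let ?l = "\<lambda>i. dot3 (a i)"
  show ?case
  proof (cases "\<exists>i\<in>I. \<exists>j\<in>I. i \<noteq> j \<and> ?l i x = 0 \<and> ?l j x = 0")
    case True
    then obtain i j where ij: "i \<in> I" "j \<in> I" "i \<noteq> j" "?l i x = 0" "?l j x = 0" by blast
    obtain k where k: "k \<in> I" "k \<noteq> i" "k \<noteq> j" using exists_third[OF card] by blast
    let ?t = "triple_prod (a i) (a j) (a k)" and ?u = "cross_prod (a i) (a j)"
    have t: "?t \<noteq> 0" using generic_positionD[OF gen] ij k by metis
    have d: "?l k x \<noteq> 0" using triple_prod_essential[OF t ij(4,5)] less.prems by blast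
    define r where "r = ?l k x / ?t"
    have "?t *s x = ?t *s (r *s ?u)"
      using cramer3[OF ij(4,5), of "a k"] t by (simp add: r_def)
    then have x: "x = r *s ?u" using t by (simp add: vec_eq_3)
    have "r \<noteq> 0" using t d by (simp add: r_def)
    then have "sgn r \<in> {1, -1}" by (simp add: sgn_if)
    moreover have "conformal I ?l (sgn r *s ?u) x"
      unfolding conformal_def x by (simp add: sgn_mult)
    ultimately show ?thesis using ij by blast
  next
    case False
    \<comment> \<open>At most one form vanishes at \<open>x\<close>; \<open>i\<close> is that one,
      or arbitrary if there is none.\<close>
    obtain i where i: "i \<in> I" "\<And>m. m \<in> I \<Longrightarrow> ?l m x = 0 \<Longrightarrow> m = i"
    proof (cases "\<exists>i\<in>I. ?l i x = 0")
      case True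
      then show ?thesis using that False by blast
    next
      case zf: False
      then show ?thesis using that exists_third[OF card] by blast
    qed
    obtain j where j: "j \<in> I" "j \<noteq> i" using exists_third[OF card] by blast
    obtain k where k: "k \<in> I" "k \<noteq> i" "k \<noteq> j" using exists_third[OF card] by blast
    \<comment> \<open>This sign makes \<open>u\<close> and \<open>x\<close> agree at
      \<open>k\<close>, so moving along \<open>- u\<close> hits a plane. Since \<open>u\<close> lies
      on the plane \<open>j\<close>, that form keeps its nonzero value and the new point is not
      0.\<close>
    define s where "s = sgn (triple_prod (a i) (a j) (a k) * ?l k x)"
    define u where "u = s *s cross_prod (a i) (a j)"
    have t: "triple_prod (a i) (a j) (a k) \<noteq> 0" using generic_positionD[OF gen] i(1) j k by metis
    have kx: "?l k x \<noteq> 0" using i(2) k by blast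
    have "?l k u * ?l k x = \<bar>triple_prod (a i) (a j) (a k) * ?l k x\<bar>"
      by (simp add: u_def s_def triple_prod_def linordered_idom_class.abs_sgn mult_ac)
    then have pos: "?l k u * ?l k x > 0" using t kx by simp
    have iju: "?l i u = 0" "?l j u = 0"
      by (simp_all add: u_def triple_prod_def[symmetric])
    have zero: "?l m u = 0" if "m \<in> I" "?l m x = 0" for m
      using i(2)[OF that] iju by simp
    obtain t m where t: "t > 0" "conformal I ?l (x - t *s u) x" "m \<in> I" "?l m x \<noteq> 0"
      "?l m (x - t *s u) = 0"
      using exists_conformal_exit[OF fin linear_form_dot3, of a x u, OF zero] pos k(1) by blast
    have "?l j (x - t *s u) = ?l j x"
      using iju(2) by (simp add: linear_form_simps[OF linear_form_dot3])
    then have y0: "x - t *s u \<noteq> 0"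
      using i(2)[OF j(1)] j(2) by (metis linear_form_0[OF linear_form_dot3])
    have "support I ?l (x - t *s u) \<subset> support I ?l x"
      using t by (auto simp: support_def conformal_def sgn_0_0)
    then have "card (support I ?l (x - t *s u)) < card (support I ?l x)"
      using fin by (intro psubset_card_mono) (auto simp: support_def)
    from less.hyps[OF this y0] show ?thesis using conformal_trans[OF _ t(2)] by meson
  qed
qed

text \<open>A positive factor keeps all signs and turns the height into its own sign. Partner rays
  with equal signs of heights then have equal heights.\<close>

definition height_normalize :: "'a::linordered_field ^ 3 \<Rightarrow> 'a ^ 3" where
  "height_normalize u = (if u $ 3 = 0 then u else (1 / \<bar>u $ 3\<bar>) *s u)"

lemma sgn_dot3_height_normalize [simp]: "sgn (dot3 b (height_normalize u)) = sgn (dot3 b u)"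
  by (simp add: height_normalize_def sgn_mult sgn_divide)

lemma height_normalize_nth_3: "height_normalize u $ 3 = sgn (u $ 3)"
  by (simp add: height_normalize_def sgn_if)

lemma height_normalize_nonzero: "u \<noteq> 0 \<Longrightarrow> height_normalize u \<noteq> 0"
  by (auto simp: height_normalize_def vec_eq_3)

lemma conformal_height_normalize:
  "conformal I (\<lambda>i. dot3 (a i)) (height_normalize u) x \<longleftrightarrow> conformal I (\<lambda>i. dot3 (a i)) u x"
  by (rule conformal_cong) simp_all

theorem piecewise_linear_automorphism_of_same_orientation:
  fixes a a' :: "'i \<Rightarrow> 'a::linordered_field ^ 3"
  assumes fin: "finite I" and card: "3 \<le> card I"
    and o: "o' \<in> I" "a o' = vector [0, 0, 1]" "a' o' = vector [0, 0, 1]"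
    and gen: "generic_position I a" and \<delta>: "\<delta> \<in> {1, -1}"
    and sgn: "\<And>i j k. \<lbrakk>i \<in> I; j \<in> I; k \<in> I; i \<noteq> j; i \<noteq> k; j \<noteq> k\<rbrakk> \<Longrightarrow>
      sgn (triple_prod (a' i) (a' j) (a' k)) = \<delta> * sgn (triple_prod (a i) (a j) (a k))"
  shows "\<exists>f. piecewise_linear_automorphism f \<and>
    (\<forall>i\<in>I. f ` {x. aff (a i) x = 0} = {x. aff (a' i) x = 0})"
proof -
  have \<delta>\<delta>: "\<delta> * \<delta> = 1" "\<delta> \<noteq> 0" "sgn \<delta> = \<delta>" using \<delta> by auto
  have gen': "generic_position I a'"
    unfolding generic_position_def
  proof (intro ballI impI)
    fix i j k assume *: "i \<in> I" "j \<in> I" "k \<in> I" "i \<noteq> j \<and> i \<noteq> k \<and> j \<noteq> k"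
    then have "sgn (triple_prod (a i) (a j) (a k)) \<noteq> 0"
      using generic_positionD[OF gen] by (simp add: sgn_0_0)
    then have "sgn (triple_prod (a' i) (a' j) (a' k)) \<noteq> 0" using sgn * \<delta>\<delta>(2) by simp
    then show "triple_prod (a' i) (a' j) (a' k) \<noteq> 0" by (simp add: sgn_0_0)
  qed
  have sgn': "sgn (triple_prod (a' i) (a' j) (a' k)) = \<delta> * sgn (triple_prod (a i) (a j) (a k))"
    if "i \<in> I" "j \<in> I" "k \<in> I" "i \<noteq> j" for i j k
    using sgn[of i j k] that by (cases "k = i \<or> k = j") auto
  define w where "w i j s = height_normalize (s *s cross_prod (a i) (a j))" for i j s
  \<comment> \<open>The extra \<delta> cancels the global sign, so that partner rays take equal
    signs on all forms.\<close>
  define w' where "w' i j s = height_normalize ((\<delta> * s) *s cross_prod (a' i) (a' j))" for i j s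
  \<comment> \<open>Enumerating pairs gives partner rays the same index, hence the same priority in
    both systems.\<close>
  define W where "W = (\<lambda>(i, j, s). (w i j s, w' i j s)) ` {(i, j, s). i \<in> I \<and> j \<in> I \<and> i \<noteq> j \<and> s \<in> {1, -1}}"
  have "{(i, j, s). i \<in> I \<and> j \<in> I \<and> i \<noteq> j \<and> s \<in> {1, -1 :: 'a}} \<subseteq> I \<times> I \<times> {1, -1}" by auto
  then have "finite {(i, j, s). i \<in> I \<and> j \<in> I \<and> i \<noteq> j \<and> s \<in> {1, -1 :: 'a}}"
    by (rule finite_subset) (simp add: fin)
  then have "finite W" unfolding W_def by (rule finite_imageI)
  then obtain ws where ws: "set ws = W" using finite_list by blast
  define v where "v k = fst (ws ! k)" for k
  define v' where "v' k = snd (ws ! k)" for k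
  let ?K = "length ws"
  have index: "\<exists>i j s. i \<in> I \<and> j \<in> I \<and> i \<noteq> j \<and> s \<in> {1, -1} \<and> v k = w i j s \<and> v' k = w' i j s"
    if "k < ?K" for k
  proof -
    have "ws ! k \<in> W" using that ws nth_mem by blast
    then obtain p where "ws ! k = (\<lambda>(i, j, s). (w i j s, w' i j s)) p"
      "p \<in> {(i, j, s). i \<in> I \<and> j \<in> I \<and> i \<noteq> j \<and> s \<in> {1, -1}}" unfolding W_def by blast
    then show ?thesis unfolding v_def v'_def by (cases p) fastforce
  qed
  have surj: "\<exists>k<?K. v k = w i j s \<and> v' k = w' i j s"
    if "i \<in> I" "j \<in> I" "i \<noteq> j" "s \<in> {1, -1}" for i j s
  proof -
    have "(w i j s, w' i j s) \<in> W"
      unfolding W_def using that by (intro image_eqI[of _ _ "(i, j, s)"]) auto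
    then obtain k where "k < ?K" "ws ! k = (w i j s, w' i j s)"
      using ws by (metis in_set_conv_nth)
    then show ?thesis by (auto simp: v_def v'_def)
  qed
  have nonzero: "cross_prod (b i) (b j) \<noteq> 0"
    if "generic_position I b" "i \<in> I" "j \<in> I" "i \<noteq> j" for b :: "'i \<Rightarrow> 'a ^ 3" and i j
  proof
    assume "cross_prod (b i) (b j) = 0"
    moreover obtain k where "k \<in> I" "k \<noteq> i" "k \<noteq> j" using exists_third[OF card] by blast
    ultimately have "triple_prod (b i) (b j) (b k) = 0" "triple_prod (b i) (b j) (b k) \<noteq> 0"
      using generic_positionD[OF that(1,2,3)] that(4)
      by (auto simp: triple_prod_def linear_form_0[OF linear_form_dot3])
    then show False by blast
  qed
  have essential: "x = 0"
    if "generic_position I b" "\<And>i. i \<in> I \<Longrightarrow> dot3 (b i) x = 0" for b :: "'i \<Rightarrow> 'a ^ 3" and x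
  proof -
    obtain i where i: "i \<in> I" using o(1) by blast
    obtain j where j: "j \<in> I" "j \<noteq> i" using exists_third[OF card] by blast
    obtain k where k: "k \<in> I" "k \<noteq> i" "k \<noteq> j" using exists_third[OF card] by blast
    have "triple_prod (b i) (b j) (b k) \<noteq> 0" using generic_positionD[OF that(1)] i j k by metis
    then show ?thesis using that(2) i j k by (intro triple_prod_essential[of "b i" "b j" "b k"])
  qed
  interpret A: vertex_system I "\<lambda>i. dot3 (a i)" ?K v
  proof
    fix k assume "k < ?K"
    from index[OF this] obtain i j s where "i \<in> I" "j \<in> I" "i \<noteq> j" "s \<in> {1, -1}" "v k = w i j s"
      by blast
    then show "v k \<noteq> 0" using nonzero[OF gen, of i j]
      by (auto simp: w_def intro!: height_normalize_nonzero)
  next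
    fix x :: "'a ^ 3" assume "x \<noteq> 0"
    from exists_conformal_cross_prod[OF fin card gen this] obtain i j s where
      *: "i \<in> I" "j \<in> I" "i \<noteq> j" "s \<in> {1, -1}"
      "conformal I (\<lambda>i. dot3 (a i)) (s *s cross_prod (a i) (a j)) x" by blast
    then show "\<exists>k<?K. conformal I (\<lambda>i. dot3 (a i)) (v k) x"
      using surj[OF *(1-4)] conformal_height_normalize unfolding w_def by metis
  qed (use fin linear_form_dot3 essential[OF gen] in auto)
  interpret B: vertex_system I "\<lambda>i. dot3 (a' i)" ?K v'
  proof
    fix k assume "k < ?K"
    from index[OF this] obtain i j s where "i \<in> I" "j \<in> I" "i \<noteq> j" "s \<in> {1, -1}" "v' k = w' i j s"
      by blast
    then show "v' k \<noteq> 0" using nonzero[OF gen', of i j] \<delta>\<delta>(2)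
      by (auto simp: w'_def intro!: height_normalize_nonzero)
  next
    fix x :: "'a ^ 3" assume "x \<noteq> 0"
    from exists_conformal_cross_prod[OF fin card gen' this] obtain i j s where
      *: "i \<in> I" "j \<in> I" "i \<noteq> j" "s \<in> {1, -1}"
      "conformal I (\<lambda>i. dot3 (a' i)) (s *s cross_prod (a' i) (a' j)) x" by blast
    have "\<delta> * s \<in> {1, -1}" using * \<delta> by auto
    from surj[OF *(1-3) this] obtain k where "k < ?K" "v' k = w' i j (\<delta> * s)" by blast
    moreover have "w' i j (\<delta> * s) = height_normalize (s *s cross_prod (a' i) (a' j))"
      by (simp add: w'_def mult.assoc[symmetric] \<delta>\<delta>)
    ultimately show "\<exists>k<?K. conformal I (\<lambda>i. dot3 (a' i)) (v' k) x"
      using *(5) conformal_height_normalize by metis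
  qed (use fin linear_form_dot3 essential[OF gen'] in auto)
  interpret P: vertex_system_pair I "\<lambda>i. dot3 (a i)" ?K v "\<lambda>i. dot3 (a' i)" v'
  proof
    fix k m assume km: "k < ?K" "m \<in> I"
    from index[OF km(1)] obtain i j s where
      *: "i \<in> I" "j \<in> I" "i \<noteq> j" "v k = w i j s" "v' k = w' i j s" by blast
    have "sgn (dot3 (a' m) (v' k)) = \<delta> * sgn s * sgn (triple_prod (a' i) (a' j) (a' m))"
      by (simp add: * w'_def sgn_mult \<delta>\<delta> triple_prod_def)
    also have "\<dots> = sgn s * sgn (triple_prod (a i) (a j) (a m))"
      using sgn'[OF *(1,2) km(2) *(3)] \<delta>\<delta>(1) by (simp add: algebra_simps)
    also have "\<dots> = sgn (dot3 (a m) (v k))"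
      by (simp add: * w_def sgn_mult triple_prod_def)
    finally show "sgn (dot3 (a' m) (v' k)) = sgn (dot3 (a m) (v k))" .
  qed
  have height: "dot3 (a o') x = x $ 3" "dot3 (a' o') x = x $ 3" for x
    using o by (simp_all add: dot3_def)
  have "v' k $ 3 = v k $ 3" if k: "k < ?K" for k
  proof -
    have s: "sgn (v' k $ 3) = sgn (v k $ 3)"
      using P.sgn_vertex[OF k o(1)] by (simp add: height)
    from index[OF k] obtain i j s where *: "v k = w i j s" "v' k = w' i j s" by blast
    have "sgn (w i j s $ 3) = w i j s $ 3" "sgn (w' i j s $ 3) = w' i j s $ 3"
      by (simp_all add: w_def w'_def height_normalize_nth_3)
    then show ?thesis using s * by simp
  qed
  then show ?thesis
    using piecewise_linear_automorphism_of_vertex_systems[OF P.vertex_system_pair_axioms] by blast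
qed

section \<open>Signs from the order on the lines\<close>

abbreviation (input) infinity_form :: "'a::field ^ 3" where
  "infinity_form \<equiv> vector [0, 0, 1]"

lemma triple_prod_infinity:
  "triple_prod a b infinity_form = a $ 1 * b $ 2 - a $ 2 * b $ 1"
  by (simp add: triple_prod_def dot3_def cross_prod_def)

lemma triple_prod_scale:
  "triple_prod (r *s a) b c = r * triple_prod a b c"
  "triple_prod a (r *s b) c = r * triple_prod a b c"
  "triple_prod a b (r *s c) = r * triple_prod a b c"
  by (simp_all add: vector3_simps)

definition lines_cross :: "'i set \<Rightarrow> ('i \<Rightarrow> 'a::linordered_field ^ 3) \<Rightarrow> bool" where
  "lines_cross J a \<longleftrightarrow>
     (\<forall>i\<in>J. \<forall>j\<in>J. i \<noteq> j \<longrightarrow> triple_prod (a i) (a j) infinity_form \<noteq> 0)"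

text \<open>
  The line at infinity joins the arrangement as the index \<open>None\<close>; rescaling the forms of the
  second arrangement by \<open>\<delta> * \<eta> i\<close> makes all orientations agree up to the global sign \<open>\<delta>\<close>.
\<close>

lemma piecewise_linear_automorphism_of_signs:
  fixes a b :: "'i \<Rightarrow> 'a::linordered_field ^ 3"
  assumes fin: "finite J" and card: "2 \<le> card J"
    and cr: "lines_cross J a" and gen: "generic_position J a"
    and \<delta>: "\<delta> \<in> {1, -1}" and \<eta>: "\<And>i. i \<in> J \<Longrightarrow> \<eta> i \<in> {1, -1}"
    and D: "\<And>i j. \<lbrakk>i \<in> J; j \<in> J; i \<noteq> j\<rbrakk> \<Longrightarrow> sgn (triple_prod (b i) (b j) infinity_form) =
      \<delta> * \<eta> i * \<eta> j * sgn (triple_prod (a i) (a j) infinity_form)"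
    and T: "\<And>i j k. \<lbrakk>i \<in> J; j \<in> J; k \<in> J; i \<noteq> j; i \<noteq> k; j \<noteq> k\<rbrakk> \<Longrightarrow>
      sgn (triple_prod (b i) (b j) (b k)) =
      \<eta> i * \<eta> j * \<eta> k * sgn (triple_prod (a i) (a j) (a k))"
  shows "\<exists>f. piecewise_linear_automorphism f \<and>
    (\<forall>i\<in>J. f ` {x. aff (a i) x = 0} = {x. aff (b i) x = 0})"
proof -
  let ?I = "insert None (Some ` J)"
  define a1 where "a1 = case_option infinity_form a"
  \<comment> \<open>In each determinant the \<open>\<eta>\<close> factors become squares. What
    remains is \<delta>^3 = \<delta> for three lines, and \<delta>^2 * \<delta> = \<delta> when one
    form is at infinity, the last factor coming from \<open>D\<close>.\<close>
  define b1 where "b1 = case_option infinity_form (\<lambda>i. (\<delta> * \<eta> i) *s b i)"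
  have sq: "\<eta> i * \<eta> i = 1" "\<eta> i \<noteq> 0" "sgn (\<eta> i) = \<eta> i" if "i \<in> J" for i
    using \<eta>[OF that] by auto
  have \<delta>\<delta>: "\<delta> * \<delta> = 1" "\<delta> \<noteq> 0" "sgn \<delta> = \<delta>" using \<delta> by auto
  have two: "triple_prod (a1 i) (a1 j) (a1 k) \<noteq> 0 \<and>
      sgn (triple_prod (b1 i) (b1 j) (b1 k)) = \<delta> * sgn (triple_prod (a1 i) (a1 j) (a1 k))"
    if ij: "i = Some p" "j = Some q" "k = None" "p \<in> J" "q \<in> J" "p \<noteq> q" for i j k p q
  proof -
    have "sgn (triple_prod (b1 i) (b1 j) (b1 k)) =
        (\<delta> * \<delta>) * \<delta> * (\<eta> p * \<eta> p) * (\<eta> q * \<eta> q) * sgn (triple_prod (a p) (a q) infinity_form)"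
      using D[of p q] ij
      by (simp add: b1_def triple_prod_scale sgn_mult sq(3) \<delta>\<delta>(3) mult_ac)
    then show ?thesis using cr ij by (simp add: a1_def lines_cross_def sq \<delta>\<delta>(1))
  qed
  have three: "triple_prod (a1 i) (a1 j) (a1 k) \<noteq> 0 \<and>
      sgn (triple_prod (b1 i) (b1 j) (b1 k)) = \<delta> * sgn (triple_prod (a1 i) (a1 j) (a1 k))"
    if ijk: "i = Some p" "j = Some q" "k = Some r" "p \<in> J" "q \<in> J" "r \<in> J" "p \<noteq> q" "p \<noteq> r" "q \<noteq> r"
    for i j k p q r
  proof -
    have "sgn (triple_prod (b1 i) (b1 j) (b1 k)) =
        (\<delta> * \<delta>) * \<delta> * (\<eta> p * \<eta> p) * (\<eta> q * \<eta> q) * (\<eta> r * \<eta> r) * sgn (triple_prod (a p) (a q) (a r))"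
      using T[of p q r] ijk
      by (simp add: b1_def triple_prod_scale sgn_mult sq(3) \<delta>\<delta>(3) mult_ac)
    then show ?thesis
      using generic_positionD[OF gen, of p q r] ijk by (simp add: a1_def sq \<delta>\<delta>(1))
  qed
  have all: "triple_prod (a1 i) (a1 j) (a1 k) \<noteq> 0 \<and>
      sgn (triple_prod (b1 i) (b1 j) (b1 k)) = \<delta> * sgn (triple_prod (a1 i) (a1 j) (a1 k))"
    if ijk: "i \<in> ?I" "j \<in> ?I" "k \<in> ?I" "i \<noteq> j" "i \<noteq> k" "j \<noteq> k" for i j k
  proof -
    consider "i = None" | "j = None" | "k = None" | "i \<noteq> None" "j \<noteq> None" "k \<noteq> None" by blast
    then show ?thesis
    proof cases
      case 1
      then obtain p q where "j = Some p" "k = Some q" "p \<in> J" "q \<in> J" "p \<noteq> q" using ijk by auto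
      from two[OF this(1,2) 1 this(3-5)] show ?thesis by (simp add: triple_prod_rotate)
    next
      case 2
      then obtain p q where "k = Some p" "i = Some q" "p \<in> J" "q \<in> J" "p \<noteq> q" using ijk by auto
      from two[OF this(1,2) 2 this(3-5)] show ?thesis
        by (simp add: triple_prod_rotate[of "a1 i" "a1 j" "a1 k"] triple_prod_rotate[of "b1 i" "b1 j" "b1 k"]
            triple_prod_rotate[of "a1 k" "a1 i" "a1 j", symmetric] triple_prod_rotate[of "b1 k" "b1 i" "b1 j", symmetric])
    next
      case 3
      then obtain p q where "i = Some p" "j = Some q" "p \<in> J" "q \<in> J" "p \<noteq> q" using ijk by auto
      from two[OF this(1,2) 3 this(3-5)] show ?thesis .
    next
      case 4
      then obtain p q r where "i = Some p" "j = Some q" "k = Some r" "p \<in> J" "q \<in> J" "r \<in> J"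
        using ijk by auto
      with ijk three[OF this] show ?thesis by auto
    qed
  qed
  have "card ?I = Suc (card J)"
    using fin by (simp add: card_image)
  then have "3 \<le> card ?I" using card by simp
  moreover have "finite ?I" using fin by simp
  moreover have "generic_position ?I a1"
    unfolding generic_position_def using all by blast
  ultimately have "\<exists>f. piecewise_linear_automorphism f \<and>
    (\<forall>i\<in>?I. f ` {x. aff (a1 i) x = 0} = {x. aff (b1 i) x = 0})"
    by (intro piecewise_linear_automorphism_of_same_orientation[where o' = None and \<delta> = \<delta>])
      (use all \<delta> in \<open>simp_all add: a1_def b1_def\<close>)
  then obtain f where f: "piecewise_linear_automorphism f"
    "\<forall>i\<in>?I. f ` {x. aff (a1 i) x = 0} = {x. aff (b1 i) x = 0}" by blast
  have "{x. aff (b1 (Some i)) x = 0} = {x. aff (b i) x = 0}" if "i \<in> J" for i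
  proof -
    have "aff (b1 (Some i)) x = \<delta> * \<eta> i * aff (b i) x" for x
      by (simp add: b1_def dot3_def algebra_simps)
    then show ?thesis using sq(2)[OF that] \<delta>\<delta>(2) by simp
  qed
  then have "\<forall>i\<in>J. f ` {x. aff (a i) x = 0} = {x. aff (b i) x = 0}"
    using f(2) by (simp add: a1_def)
  then show ?thesis using f(1) by blast
qed

section \<open>Comparing the sign patterns of two arrangements\<close>

lemma sgn_pm1: "x \<noteq> 0 \<Longrightarrow> sgn x \<in> {1, -1 :: 'a::linordered_field}"
  by (simp add: sgn_if)

lemma pm1_mult: "x \<in> {1, -1 :: 'a::linordered_field} \<Longrightarrow> y \<in> {1, -1} \<Longrightarrow> x * y \<in> {1, -1}"
  by auto

lemma pm1_move:
  fixes x y z :: "'a::linordered_field"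
  shows "x \<in> {1, -1} \<Longrightarrow> x * y = z \<Longrightarrow> y = z * x"
  by auto

lemma pm1_rearrange:
  fixes t t' d d' e e' h :: "'a::linordered_field"
  assumes "t \<in> {1, -1}" "d' \<in> {1, -1}" "e' \<in> {1, -1}"
    and "t' * d' * e' = h * (t * d * e)"
  shows "t * t' = h * (d * d') * (e * e')"
  using assms by (auto simp: minus_equation_iff)

text \<open>Comparing \<open>rel\<close> for (i, j, k) and (j, i, k) cancels \<open>r2 i j\<close>
  and gives \<open>d i k = d j k\<close>. As \<open>d\<close> is symmetric, any two pairs are then
  connected through \<open>k0\<close>.\<close>

lemma sign_coboundary:
  fixes r2 :: "'i \<Rightarrow> 'i \<Rightarrow> 'a::linordered_field" and r3 :: "'i \<Rightarrow> 'i \<Rightarrow> 'i \<Rightarrow> 'a"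
  assumes J: "i0 \<in> J" "k0 \<in> J" "i0 \<noteq> k0"
    and r2: "\<And>i j. \<lbrakk>i \<in> J; j \<in> J; i \<noteq> j\<rbrakk> \<Longrightarrow> r2 i j \<in> {1, -1} \<and> r2 j i = r2 i j"
    and r3: "\<And>i j k. \<lbrakk>i \<in> J; j \<in> J; k \<in> J; i \<noteq> j; i \<noteq> k; j \<noteq> k\<rbrakk> \<Longrightarrow> r3 j i k = r3 i j k"
    and \<eta>: "\<And>i. i \<in> J \<Longrightarrow> \<eta> i \<in> {1, -1}"
    and rel: "\<And>i j k. \<lbrakk>i \<in> J; j \<in> J; k \<in> J; i \<noteq> j; i \<noteq> k; j \<noteq> k\<rbrakk> \<Longrightarrow> r3 i j k = \<eta> i * r2 i j * r2 i k"
  shows "\<exists>\<delta>\<in>{1, -1}. (\<forall>i\<in>J. \<forall>j\<in>J. i \<noteq> j \<longrightarrow> r2 i j = \<delta> * \<eta> i * \<eta> j) \<and>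
    (\<forall>i\<in>J. \<forall>j\<in>J. \<forall>k\<in>J. i \<noteq> j \<and> i \<noteq> k \<and> j \<noteq> k \<longrightarrow> r3 i j k = \<eta> i * \<eta> j * \<eta> k)"
proof -
  define d where "d i j = r2 i j * \<eta> i * \<eta> j" for i j
  have d: "d i j \<in> {1, -1}" "d j i = d i j" "r2 i j = d i j * \<eta> i * \<eta> j"
    if "i \<in> J" "j \<in> J" "i \<noteq> j" for i j
    using r2[OF that] \<eta>[OF that(1)] \<eta>[OF that(2)] by (auto simp: d_def)
  have move: "d i k = d j k" if *: "i \<in> J" "j \<in> J" "k \<in> J" "i \<noteq> j" "i \<noteq> k" "j \<noteq> k" for i j k
  proof -
    have "\<eta> i * r2 i j * r2 i k = \<eta> j * r2 j i * r2 j k"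
      using rel[of i j k] rel[of j i k] r3[of i j k] * by auto
    then show ?thesis
      using r2[of i j] r2[of i k] r2[of j k] \<eta>[of i] \<eta>[of j] \<eta>[of k] *
      by (auto simp: d_def)
  qed
  define \<delta> where "\<delta> = d i0 k0"
  have \<delta>: "\<delta> \<in> {1, -1}" using d(1) J by (simp add: \<delta>_def)
  have k0: "d i k0 = \<delta>" if "i \<in> J" "i \<noteq> k0" for i
    using move[of i i0 k0] that J by (cases "i = i0") (auto simp: \<delta>_def)
  have const: "d i j = \<delta>" if *: "i \<in> J" "j \<in> J" "i \<noteq> j" for i j
  proof (cases "i = k0 \<or> j = k0")
    case True
    then show ?thesis using k0[of i] k0[of j] d(2)[of i j] * by metis
  next
    case False
    then have "d i j = d k0 j" using move[of i k0 j] * J by blast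
    then show ?thesis using k0[of j] d(2)[of k0 j] J False * by metis
  qed
  have c2: "r2 i j = \<delta> * \<eta> i * \<eta> j" if "i \<in> J" "j \<in> J" "i \<noteq> j" for i j
    using d(3)[OF that] const[OF that] by simp
  have c3: "r3 i j k = \<eta> i * \<eta> j * \<eta> k"
    if "i \<in> J" "j \<in> J" "k \<in> J" "i \<noteq> j" "i \<noteq> k" "j \<noteq> k" for i j k
    using rel[OF that] c2[of i j] c2[of i k] \<eta>[of i] \<delta> that by auto
  show ?thesis using \<delta> c2 c3 by blast
qed

text \<open>
  For lines \<open>a\<close>, \<open>b\<close>, \<open>c\<close> this tells, up to a sign depending only on \<open>a\<close>, in which order \<open>b\<close> and
  \<open>c\<close> meet \<open>a\<close>.
\<close>

definition order_sign :: "'a::linordered_field ^ 3 \<Rightarrow> 'a ^ 3 \<Rightarrow> 'a ^ 3 \<Rightarrow> 'a" where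
  "order_sign a b c = sgn (triple_prod a b c) * sgn (triple_prod a b infinity_form) *
     sgn (triple_prod a c infinity_form)"

lemma piecewise_linear_automorphism_of_betweenness:
  fixes a b :: "'i \<Rightarrow> 'a::linordered_field ^ 3"
  assumes fin: "finite J" and card: "2 \<le> card J"
    and a: "lines_cross J a" "generic_position J a" and b: "lines_cross J b"
    and \<eta>: "\<And>i. i \<in> J \<Longrightarrow> \<eta> i \<in> {1, -1}"
    and rel: "\<And>i j k. \<lbrakk>i \<in> J; j \<in> J; k \<in> J; i \<noteq> j; i \<noteq> k; j \<noteq> k\<rbrakk> \<Longrightarrow>
      order_sign (b i) (b j) (b k) = \<eta> i * order_sign (a i) (a j) (a k)"
  shows "\<exists>f. piecewise_linear_automorphism f \<and>
    (\<forall>i\<in>J. f ` {x. aff (a i) x = 0} = {x. aff (b i) x = 0})"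
proof -
  let ?D = "\<lambda>c i j. sgn (triple_prod (c i) (c j) infinity_form) :: 'a"
  let ?T = "\<lambda>c i j k. sgn (triple_prod (c i) (c j) (c k)) :: 'a"
  have D: "?D c i j \<in> {1, -1}" if "lines_cross J c" "i \<in> J" "j \<in> J" "i \<noteq> j" for c i j
    using that by (intro sgn_pm1) (simp add: lines_cross_def)
  have T: "?T c i j k \<in> {1, -1}"
    if "generic_position J c" "i \<in> J" "j \<in> J" "k \<in> J" "i \<noteq> j" "i \<noteq> k" "j \<noteq> k" for c i j k
    using generic_positionD[OF that] by (rule sgn_pm1)
  have Dswap: "?D c j i = - ?D c i j" and Tswap: "?T c j i k = - ?T c i j k" for c i j k
    using triple_prod_swap[of "c j" "c i"] by (simp_all add: sgn_minus)
  obtain i0 where i0: "i0 \<in> J" using card by (metis card.empty ex_in_conv not_numeral_le_zero)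
  have "J \<noteq> {i0}" using card by auto
  then obtain k0 where k0: "k0 \<in> J" "i0 \<noteq> k0" using i0 by blast
  \<comment> \<open>Products of two signs serve as their quotients. Both factors change sign under a
    swap, so \<open>r2\<close> and \<open>r3\<close> are symmetric.\<close>
  define r2 where "r2 i j = ?D a i j * ?D b i j" for i j
  define r3 where "r3 i j k = ?T a i j k * ?T b i j k" for i j k
  have "\<exists>\<delta>\<in>{1, -1}. (\<forall>i\<in>J. \<forall>j\<in>J. i \<noteq> j \<longrightarrow> r2 i j = \<delta> * \<eta> i * \<eta> j) \<and>
    (\<forall>i\<in>J. \<forall>j\<in>J. \<forall>k\<in>J. i \<noteq> j \<and> i \<noteq> k \<and> j \<noteq> k \<longrightarrow> r3 i j k = \<eta> i * \<eta> j * \<eta> k)"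
  proof (rule sign_coboundary[OF i0 k0 _ _ \<eta>])
    fix i j assume "i \<in> J" "j \<in> J" "i \<noteq> j"
    then show "r2 i j \<in> {1, -1} \<and> r2 j i = r2 i j"
      using pm1_mult[OF D[OF a(1)] D[OF b], of i j i j] Dswap[of a j i] Dswap[of b j i]
      unfolding r2_def by (metis minus_mult_minus)
  next
    fix i j k
    show "r3 j i k = r3 i j k" unfolding r3_def Tswap[of _ j i] by (rule minus_mult_minus)
  next
    fix i j k assume *: "i \<in> J" "j \<in> J" "k \<in> J" "i \<noteq> j" "i \<noteq> k" "j \<noteq> k"
    show "r3 i j k = \<eta> i * r2 i j * r2 i k"
      unfolding r2_def r3_def
      by (rule pm1_rearrange[OF T[OF a(2) *] D[OF b] D[OF b] rel[OF *, unfolded order_sign_def]]) (use * in auto)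
  qed
  then obtain \<delta> where \<delta>: "\<delta> \<in> {1, -1}"
    and c2: "\<forall>i\<in>J. \<forall>j\<in>J. i \<noteq> j \<longrightarrow> r2 i j = \<delta> * \<eta> i * \<eta> j"
    and c3: "\<forall>i\<in>J. \<forall>j\<in>J. \<forall>k\<in>J. i \<noteq> j \<and> i \<noteq> k \<and> j \<noteq> k \<longrightarrow> r3 i j k = \<eta> i * \<eta> j * \<eta> k"
    by blast
  have D': "?D b i j = \<delta> * \<eta> i * \<eta> j * ?D a i j" if "i \<in> J" "j \<in> J" "i \<noteq> j" for i j
  proof -
    have "r2 i j = \<delta> * \<eta> i * \<eta> j" using c2 that by blast
    then show ?thesis using pm1_move[OF D[OF a(1) that]] unfolding r2_def by blast
  qed
  have T': "?T b i j k = \<eta> i * \<eta> j * \<eta> k * ?T a i j k"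
    if "i \<in> J" "j \<in> J" "k \<in> J" "i \<noteq> j" "i \<noteq> k" "j \<noteq> k" for i j k
  proof -
    have "r3 i j k = \<eta> i * \<eta> j * \<eta> k" using c3 that by blast
    then show ?thesis using pm1_move[OF T[OF a(2) that]] unfolding r3_def by blast
  qed
  show ?thesis
    by (rule piecewise_linear_automorphism_of_signs[OF fin card a \<delta> \<eta> D' T'])
qed

text \<open>A single line and the line at infinity give only two forms, too few to be essential in
  dimension three. So a perpendicular through the origin is added. The determinant of the two
  normals is, up to sign, a sum of two squares, nonzero in an ordered field; for two lines the order
  condition is empty.\<close>

lemma piecewise_linear_automorphism_of_line_pair:
  fixes a b :: "'a::linordered_field ^ 3"
  assumes "a $ 1 \<noteq> 0 \<or> a $ 2 \<noteq> 0" "b $ 1 \<noteq> 0 \<or> b $ 2 \<noteq> 0"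
  shows "\<exists>f. piecewise_linear_automorphism f \<and> f ` {x. aff a x = 0} = {x. aff b x = 0}"
proof -
  let ?p = "\<lambda>(c :: 'a ^ 3) (t :: bool). if t then c else vector [- c $ 2, c $ 1, 0]"
  have cr: "lines_cross UNIV (?p c)" if "c $ 1 \<noteq> 0 \<or> c $ 2 \<noteq> 0" for c :: "'a ^ 3"
  proof -
    have 1: "c $ 1 * c $ 1 + c $ 2 * c $ 2 \<noteq> 0" using that by (simp add: sum_squares_eq_zero_iff)
    then have 2: "- (c $ 1 * c $ 1) - c $ 2 * c $ 2 \<noteq> 0"
      by (metis add.commute minus_add_distrib neg_equal_0_iff_equal uminus_add_conv_diff diff_conv_add_uminus)
    show ?thesis unfolding lines_cross_def
      using 1 2 by (auto simp: triple_prod_infinity algebra_simps)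
  qed
  have gen: "generic_position UNIV (?p c)" for c :: "'a ^ 3"
    unfolding generic_position_def by auto
  have no: False if "i \<noteq> j" "i \<noteq> k" "j \<noteq> k" for i j k :: bool
    using that by auto
  have "\<exists>f. piecewise_linear_automorphism f \<and>
      (\<forall>i\<in>UNIV. f ` {x. aff (?p a i) x = 0} = {x. aff (?p b i) x = 0})"
  proof (rule piecewise_linear_automorphism_of_betweenness[where \<eta> = "\<lambda>_. 1"])
    show "lines_cross UNIV (?p a)" "lines_cross UNIV (?p b)" using cr assms by blast+
    show "generic_position UNIV (?p a)" by (rule gen)
  qed (use no in \<open>simp_all add: card_UNIV_bool\<close>)
  then obtain f where f: "piecewise_linear_automorphism f"
    "\<forall>i\<in>UNIV. f ` {x. aff (?p a i) x = 0} = {x. aff (?p b i) x = 0}" by blast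
  show ?thesis using f(1) bspec[OF f(2) UNIV_I, of True] by auto
qed

text \<open>A line determines its form only up to a nonzero factor. Changing the sign of a form
  flips \<open>order_sign\<close> if it is the first argument and leaves it unchanged in the other
  positions, so the choice is absorbed by \<eta>.\<close>

definition line_form :: "('a::linordered_field ^ 2) set \<Rightarrow> 'a ^ 3" where
  "line_form L = (SOME a. (a $ 1 \<noteq> 0 \<or> a $ 2 \<noteq> 0) \<and> L = {x. aff a x = 0})"

lemma line_form:
  assumes "is_line L"
  shows "line_form L $ 1 \<noteq> 0 \<or> line_form L $ 2 \<noteq> 0" "L = {x. aff (line_form L) x = 0}"
proof -
  obtain v w where w: "w \<noteq> 0" "L = line_through v w" using assms by (auto simp: is_line_def)
  let ?a = "vector [- w $ 2, w $ 1, w $ 2 * v $ 1 - w $ 1 * v $ 2] :: 'a ^ 3"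
  have "?a $ 1 \<noteq> 0 \<or> ?a $ 2 \<noteq> 0" using w(1) by (auto simp: vec_eq_2)
  moreover from this have "{x. aff ?a x = 0} = line_through v w"
    by (rule zero_set_eq_line_through) (simp_all add: aff_eq w)
  ultimately have "\<exists>a. (a $ 1 \<noteq> 0 \<or> a $ 2 \<noteq> 0) \<and> L = {x. aff a x = 0}" using w(2) by blast
  from someI_ex[OF this] show "line_form L $ 1 \<noteq> 0 \<or> line_form L $ 2 \<noteq> 0"
    "L = {x. aff (line_form L) x = 0}" unfolding line_form_def by blast+
qed

lemma line_form_iff: "is_line L \<Longrightarrow> aff (line_form L) x = 0 \<longleftrightarrow> x \<in> L"
  using line_form(2) by blast

text \<open>\<open>homogenize p\<close> has height 1, so it is the cross product divided by its
  height. A third form at the intersection point is thus a quotient of determinants.\<close>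

lemma aff_at_intersection:
  fixes a b c :: "'a::linordered_field ^ 3"
  assumes "aff a p = 0" "aff b p = 0"
  shows "triple_prod a b infinity_form * aff c p = triple_prod a b c"
proof -
  have "triple_prod a b infinity_form *s homogenize p = cross_prod a b"
    using cramer3[OF assms, of infinity_form] by (simp add: dot3_def)
  then show ?thesis by (metis dot3_scale triple_prod_def)
qed

lemma intersection_exists:
  fixes a b :: "'a::linordered_field ^ 3"
  assumes "triple_prod a b infinity_form \<noteq> 0"
  shows "\<exists>p. aff a p = 0 \<and> aff b p = 0"
proof -
  let ?d = "triple_prod a b infinity_form"
  let ?x = "(1 / ?d) *s cross_prod a b"
  have "dot3 infinity_form (cross_prod a b) = cross_prod a b $ 3" by (simp add: dot3_def)
  then have "?x $ 3 = 1" using assms by (simp add: triple_prod_def)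
  then have h: "homogenize (plane_coordinates ?x) = ?x" by (rule homogenize_plane_coordinates)
  have "dot3 a (cross_prod a b) = 0" "dot3 b (cross_prod a b) = 0"
    by (simp_all flip: triple_prod_def)
  then show ?thesis by (intro exI[of _ "plane_coordinates ?x"]) (simp add: h)
qed

lemma line_arrangement_forms:
  fixes A :: "('a::linordered_field ^ 2) set set"
  assumes "line_arrangement n A"
  shows "lines_cross A line_form" "generic_position A line_form"
proof -
  have line: "is_line L" if "L \<in> A" for L using assms that by (simp add: line_arrangement_def)
  have cr: "triple_prod (line_form L) (line_form M) infinity_form \<noteq> 0"
    if LM: "L \<in> A" "M \<in> A" "L \<noteq> M" for L M
  proof
    let ?a = "line_form L" and ?b = "line_form M"
    assume 0: "triple_prod ?a ?b infinity_form = 0"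
    \<comment> \<open>A direction of \<open>L\<close>; the vanishing determinant makes it a
      direction of \<open>M\<close> as well.\<close>
    define w :: "'a ^ 2" where "w = vector [- ?a $ 2, ?a $ 1]"
    have w: "w \<noteq> 0" using line_form(1)[OF line[OF LM(1)]] by (auto simp: w_def vec_eq_2)
    obtain v v' where v: "v \<in> L" "v' \<in> M"
      using line[OF LM(1)] line[OF LM(2)] unfolding is_line_def line_through_def by blast
    have "?a $ 1 * w $ 1 + ?a $ 2 * w $ 2 = 0" "?b $ 1 * w $ 1 + ?b $ 2 * w $ 2 = 0"
      using 0 by (simp_all add: w_def triple_prod_infinity algebra_simps)
    then have "L = line_through v w" "M = line_through v' w"
      using zero_set_eq_line_through[OF line_form(1)[OF line] _ w] v LM line_form_iff[OF line]
        line_form(2)[OF line] by metis+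
    then have "parallel_lines L M" using w unfolding parallel_lines_def by blast
    then show False using assms LM by (simp add: line_arrangement_def)
  qed
  then show "lines_cross A line_form" by (simp add: lines_cross_def)
  show "generic_position A line_form"
    unfolding generic_position_def
  proof (intro ballI impI)
    fix L M N assume *: "L \<in> A" "M \<in> A" "N \<in> A" "L \<noteq> M \<and> L \<noteq> N \<and> M \<noteq> N"
    have d: "triple_prod (line_form L) (line_form M) infinity_form \<noteq> 0" using cr * by blast
    then obtain p where p: "aff (line_form L) p = 0" "aff (line_form M) p = 0"
      using intersection_exists by blast
    then have "p \<in> L \<inter> M" using line_form_iff[OF line] * by blast
    then have "p \<notin> N" using assms * unfolding line_arrangement_def by blast
    then have "aff (line_form N) p \<noteq> 0" using line_form_iff[OF line] * by blast
    then show "triple_prod (line_form L) (line_form M) (line_form N) \<noteq> 0"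
      using aff_at_intersection[OF p, of "line_form N"] d by auto
  qed
qed

text \<open>
  The factor \<open>\<kappa>\<close> compares the direction \<open>w\<close> of a parametrization of the line \<open>a = 0\<close> with the
  direction determined by the form \<open>a\<close>.
\<close>

lemma triple_prod_along_line:
  fixes a b c :: "'a::linordered_field ^ 3"
  assumes "aff a p = 0" "aff a q = 0" "aff b p = 0" "aff c q = 0" and q: "q = p + r *s w"
    and w: "w $ 1 = - (\<kappa> * a $ 2)" "w $ 2 = \<kappa> * a $ 1"
  shows "triple_prod a b c =
    - (r * \<kappa>) * triple_prod a b infinity_form * triple_prod a c infinity_form"
proof -
  \<comment> \<open>The form \<open>b\<close> is 0 at \<open>p\<close> and changes linearly up to
    \<open>q\<close>, where \<open>a\<close> and \<open>c\<close> meet and its value is also a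
    quotient of determinants.\<close>
  have "aff b q = aff b p + r * (b $ 1 * w $ 1 + b $ 2 * w $ 2)"
    by (simp add: q aff_eq algebra_simps)
  also have "\<dots> = r * \<kappa> * triple_prod a b infinity_form"
    unfolding w triple_prod_infinity using assms(3) by (simp add: algebra_simps)
  finally have "triple_prod a c infinity_form * (r * \<kappa> * triple_prod a b infinity_form) =
      triple_prod a c b"
    using aff_at_intersection[OF assms(2,4), of b] by simp
  then show ?thesis using triple_prod_swap'[of a c b] by (simp add: mult_ac)
qed

lemma line_direction:
  fixes a :: "'a::linordered_field ^ 3"
  assumes a: "a $ 1 \<noteq> 0 \<or> a $ 2 \<noteq> 0" and w: "w \<noteq> 0" and L: "{x. aff a x = 0} = line_through v w"
  shows "\<exists>\<kappa>. \<kappa> \<noteq> 0 \<and> w $ 1 = - (\<kappa> * a $ 2) \<and> w $ 2 = \<kappa> * a $ 1"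
proof -
  have "v + 0 *s w \<in> line_through v w" "v + 1 *s w \<in> line_through v w"
    unfolding line_through_def by blast+
  then have "aff a v = 0" "aff a (v + w) = 0" unfolding L[symmetric] by simp_all
  then have f: "a $ 1 * w $ 1 + a $ 2 * w $ 2 = 0"
    by (simp add: aff_eq algebra_simps)
  define e :: "'a ^ 2" where "e = vector [- a $ 2, a $ 1]"
  define b :: "'a ^ 3" where "b = vector [a $ 1, a $ 2, 0]"
  have "e \<noteq> 0" using a by (auto simp: e_def vec_eq_2)
  then have "{x. aff b x = 0} = line_through 0 e"
    by (intro zero_set_eq_line_through) (use a in \<open>auto simp: b_def e_def aff_eq\<close>)
  moreover have "w \<in> {x. aff b x = 0}" using f by (simp add: b_def aff_eq)
  ultimately obtain k where k: "w = k *s e" by (auto simp: line_through_def)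
  then have "k \<noteq> 0" using w by auto
  then show ?thesis using k by (intro exI[of _ k]) (simp add: e_def)
qed

lemma param_le_imp_le:
  assumes "param_le v w (v + s *s w) (v + t *s w)" "w \<noteq> (0 :: 'a::linordered_field ^ 2)"
  shows "s \<le> t"
proof -
  have inj: "x = y" if "v + x *s w = v + y *s w" for x y
  proof -
    have "x * w $ 1 = y * w $ 1" "x * w $ 2 = y * w $ 2" using that by (simp_all add: vec_eq_2)
    then show ?thesis using assms(2) by (auto simp: vec_eq_2)
  qed
  show ?thesis using assms(1) inj unfolding param_le_def by blast
qed

text \<open>\<open>order_sign\<close> is the sign of a parameter difference times -sgn \<kappa>,
  which depends only on the form of the line and its parametrization. A monotone injection
  multiplies the signs of parameter differences by a constant \<theta>, so \<eta> collects \<theta>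
  and the two corrections.\<close>

lemma monotone_orientation:
  fixes a b :: "'a::linordered_field ^ 3"
  assumes mono: "monotone_between_lines \<phi> S {x. aff a x = 0} {x. aff b x = 0}"
    and a: "a $ 1 \<noteq> 0 \<or> a $ 2 \<noteq> 0" and b: "b $ 1 \<noteq> 0 \<or> b $ 2 \<noteq> 0" and inj: "inj_on \<phi> S"
    and S: "\<And>p. p \<in> S \<Longrightarrow> aff a p = 0 \<and> aff b (\<phi> p) = 0"
  obtains \<eta> where "\<eta> \<in> {1, -1}"
    and "\<And>p q c d c' d'. \<lbrakk>p \<in> S; q \<in> S; p \<noteq> q;
      aff c p = 0; aff d q = 0; aff c' (\<phi> p) = 0; aff d' (\<phi> q) = 0;
      triple_prod a c infinity_form \<noteq> 0; triple_prod a d infinity_form \<noteq> 0;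
      triple_prod b c' infinity_form \<noteq> 0; triple_prod b d' infinity_form \<noteq> 0\<rbrakk> \<Longrightarrow>
      order_sign b c' d' = \<eta> * order_sign a c d"
proof -
  obtain v w v' w' where w: "w \<noteq> 0" "w' \<noteq> 0"
    and L: "{x. aff a x = 0} = line_through v w" and L': "{x. aff b x = 0} = line_through v' w'"
    and m: "monotone_on S (param_le v w) (param_le v' w') \<phi> \<or>
      monotone_on S (param_le v w) (\<lambda>x y. param_le v' w' y x) \<phi>"
    using mono unfolding monotone_between_lines_def by blast
  obtain \<kappa> where \<kappa>: "\<kappa> \<noteq> 0" "w $ 1 = - (\<kappa> * a $ 2)" "w $ 2 = \<kappa> * a $ 1"
    using line_direction[OF a w(1) L] by blast
  obtain \<kappa>' where \<kappa>': "\<kappa>' \<noteq> 0" "w' $ 1 = - (\<kappa>' * b $ 2)" "w' $ 2 = \<kappa>' * b $ 1"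
    using line_direction[OF b w(2) L'] by blast
  define par where "par p = (SOME s. p = v + s *s w)" for p
  define par' where "par' p = (SOME s. \<phi> p = v' + s *s w')" for p
  have par: "p = v + par p *s w" if "p \<in> S" for p
  proof -
    have "p \<in> line_through v w" using S[OF that] L by blast
    then have "\<exists>s. p = v + s *s w" by (auto simp: line_through_def)
    then show ?thesis unfolding par_def by (rule someI_ex)
  qed
  have par': "\<phi> p = v' + par' p *s w'" if "p \<in> S" for p
  proof -
    have "\<phi> p \<in> line_through v' w'" using S[OF that] L' by blast
    then have "\<exists>s. \<phi> p = v' + s *s w'" by (auto simp: line_through_def)
    then show ?thesis unfolding par'_def by (rule someI_ex)
  qed
  have le: "param_le v w p q" if "p \<in> S" "q \<in> S" "par p \<le> par q" for p q
    using par that unfolding param_le_def by blast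
  have le': "par' p \<le> par' q" if "p \<in> S" "q \<in> S" "param_le v' w' (\<phi> p) (\<phi> q)" for p q
    using par'[OF that(1)] par'[OF that(2)] that(3) w(2) param_le_imp_le by metis
  \<comment> \<open>Distinct points have distinct parameters; this makes the weak monotonicity of
    \<phi> strict below.\<close>
  have ne: "par p \<noteq> par q" "par' p \<noteq> par' q" if "p \<in> S" "q \<in> S" "p \<noteq> q" for p q
    using par par' that inj by (metis, metis inj_onD)
  have "\<exists>\<theta>\<in>{1, -1}. \<forall>p\<in>S. \<forall>q\<in>S. p \<noteq> q \<longrightarrow> sgn (par' q - par' p) = \<theta> * sgn (par q - par p)"
    using m
  proof
    assume m: "monotone_on S (param_le v w) (param_le v' w') \<phi>"
    have step: "par' p < par' q" if "p \<in> S" "q \<in> S" "par p < par q" for p q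
    proof -
      have "par' p \<le> par' q" using that le le' m by (meson less_imp_le monotone_onD)
      then show ?thesis using ne[of p q] that by force
    qed
    have "sgn (par' q - par' p) = 1 * sgn (par q - par p)" if "p \<in> S" "q \<in> S" "p \<noteq> q" for p q
      using ne(1)[OF that] step[of p q] step[of q p] that
      by (cases "par p" "par q" rule: linorder_cases) (auto simp: sgn_if)
    then show ?thesis by blast
  next
    assume m: "monotone_on S (param_le v w) (\<lambda>x y. param_le v' w' y x) \<phi>"
    have step: "par' q < par' p" if "p \<in> S" "q \<in> S" "par p < par q" for p q
    proof -
      have "par' q \<le> par' p" using that le le' m by (meson less_imp_le monotone_onD)
      then show ?thesis using ne[of p q] that by force
    qed
    have "sgn (par' q - par' p) = -1 * sgn (par q - par p)" if "p \<in> S" "q \<in> S" "p \<noteq> q" for p q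
      using ne(1)[OF that] step[of p q] step[of q p] that
      by (cases "par p" "par q" rule: linorder_cases) (auto simp: sgn_if)
    then show ?thesis by blast
  qed
  then obtain \<theta> where \<theta>: "\<theta> \<in> {1, -1}" and
    sg: "\<And>p q. p \<in> S \<Longrightarrow> q \<in> S \<Longrightarrow> p \<noteq> q \<Longrightarrow> sgn (par' q - par' p) = \<theta> * sgn (par q - par p)"
    by blast
  have key: "order_sign e c d = - (sgn r * sgn k)"
    if "triple_prod e c d = - (r * k) * triple_prod e c infinity_form * triple_prod e d infinity_form"
      "triple_prod e c infinity_form \<noteq> 0" "triple_prod e d infinity_form \<noteq> 0"
    for e c d :: "'a ^ 3" and r k
  proof -
    have "sgn x * sgn x = 1" if "x \<noteq> 0" for x :: 'a using that by (simp add: sgn_if)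
    then have s: "sgn (triple_prod e c infinity_form) * sgn (triple_prod e c infinity_form) = 1"
      "sgn (triple_prod e d infinity_form) * sgn (triple_prod e d infinity_form) = 1"
      using that(2,3) by blast+
    have "sgn (triple_prod e c d) = - (sgn r * sgn k) * sgn (triple_prod e c infinity_form) *
      sgn (triple_prod e d infinity_form)"
      unfolding that(1) by (simp add: sgn_mult sgn_minus)
    then have "order_sign e c d = - (sgn r * sgn k) *
      (sgn (triple_prod e c infinity_form) * sgn (triple_prod e c infinity_form)) *
      (sgn (triple_prod e d infinity_form) * sgn (triple_prod e d infinity_form))"
      by (simp only: order_sign_def mult_ac)
    then show ?thesis unfolding s by simp
  qed
  define \<eta> where "\<eta> = \<theta> * (sgn \<kappa> * sgn \<kappa>')"
  have "\<eta> \<in> {1, -1}"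
    unfolding \<eta>_def by (intro pm1_mult sgn_pm1 \<theta> \<kappa>(1) \<kappa>'(1))
  moreover have "order_sign b c' d' = \<eta> * order_sign a c d"
    if pq: "p \<in> S" "q \<in> S" "p \<noteq> q" and z: "aff c p = 0" "aff d q = 0" "aff c' (\<phi> p) = 0" "aff d' (\<phi> q) = 0"
      and D: "triple_prod a c infinity_form \<noteq> 0" "triple_prod a d infinity_form \<noteq> 0"
        "triple_prod b c' infinity_form \<noteq> 0" "triple_prod b d' infinity_form \<noteq> 0"
    for p q c d c' d'
  proof -
    have "v + par q *s w = (v + par p *s w) + (par q - par p) *s w" by (simp add: vec_eq_2 algebra_simps)
    then have q: "q = p + (par q - par p) *s w" using par pq by metis
    have "v' + par' q *s w' = (v' + par' p *s w') + (par' q - par' p) *s w'" by (simp add: vec_eq_2 algebra_simps)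
    then have q': "\<phi> q = \<phi> p + (par' q - par' p) *s w'" using par' pq by metis
    have 1: "order_sign a c d = - (sgn (par q - par p) * sgn \<kappa>)"
      using S pq z D by (intro key triple_prod_along_line[OF _ _ _ _ q \<kappa>(2,3)]) auto
    have 2: "order_sign b c' d' = - (sgn (par' q - par' p) * sgn \<kappa>')"
      using S pq z D by (intro key triple_prod_along_line[OF _ _ _ _ q' \<kappa>'(2,3)]) auto
    have "sgn \<kappa> * sgn \<kappa> = 1" using \<kappa>(1) by (simp add: sgn_if)
    then have "\<eta> * - (sgn (par q - par p) * sgn \<kappa>) = - (\<theta> * sgn (par q - par p) * sgn \<kappa>')"
      unfolding \<eta>_def by (simp add: algebra_simps)
    then show ?thesis unfolding 1 2 sg[OF pq] by (rule sym)
  qed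
  ultimately show ?thesis by (rule that)
qed

lemma intersection_point_of_lines:
  fixes A :: "('a::linordered_field ^ 2) set set"
  assumes "line_arrangement n A" "L \<in> A" "M \<in> A" "L \<noteq> M"
  shows "\<exists>p\<in>intersection_points A. p \<in> L \<and> p \<in> M"
proof -
  have "triple_prod (line_form L) (line_form M) infinity_form \<noteq> 0"
    using line_arrangement_forms(1)[OF assms(1)] assms by (simp add: lines_cross_def)
  then obtain p where p: "aff (line_form L) p = 0" "aff (line_form M) p = 0"
    using intersection_exists by blast
  have "is_line L" "is_line M" using assms by (simp_all add: line_arrangement_def)
  then have "p \<in> L" "p \<in> M" using p line_form_iff by blast+
  then show ?thesis using assms unfolding intersection_points_def by blast
qed

lemma takes_arrangement_of_forms:
  fixes A B :: "('a::linordered_field ^ 2) set set"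
  assumes A: "line_arrangement n A" and B: "line_arrangement n B" and bij: "bij_betw \<psi> A B"
    and f: "\<And>L. L \<in> A \<Longrightarrow> f ` {x. aff (line_form L) x = 0} = {x. aff (line_form (\<psi> L)) x = 0}"
  shows "takes_arrangement f A B"
proof -
  have "f ` L = \<psi> L" if L: "L \<in> A" for L
  proof -
    have "is_line L" "is_line (\<psi> L)"
      using A B L bij_betwE[OF bij] by (simp_all add: line_arrangement_def)
    then show ?thesis using f[OF L] by (simp flip: line_form(2))
  qed
  then have "(\<lambda>L. f ` L) ` A = \<psi> ` A" by (rule image_cong[OF refl])
  then show ?thesis using bij unfolding takes_arrangement_def bij_betw_def by simp
qed

lemma lines_cross_reindex:
  fixes B :: "('a::linordered_field ^ 2) set set"
  assumes "line_arrangement n B" and "bij_betw \<psi> J B"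
  shows "lines_cross J (\<lambda>L. line_form (\<psi> L))"
proof -
  have "\<psi> L \<in> B" "\<psi> L = \<psi> M \<longleftrightarrow> L = M" if "L \<in> J" "M \<in> J" for L M
    using that assms(2) by (auto simp: bij_betw_def inj_on_eq_iff)
  then show "lines_cross J (\<lambda>L. line_form (\<psi> L))"
    using line_arrangement_forms(1)[OF assms(1)] unfolding lines_cross_def by metis
qed

text \<open>M and N meet L in different points because no three lines are concurrent, and \<phi>
  sends these points onto \<psi> M and \<psi> N. They are the points to which
  \<open>monotone_orientation\<close> is applied.\<close>

lemma matched_lines_order_sign:
  fixes A B :: "('a::linordered_field ^ 2) set set"
  assumes A: "line_arrangement n A" and B: "line_arrangement n B" and bij: "bij_betw \<psi> A B"
    and inj: "inj_on \<phi> (intersection_points A)"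
    and on: "\<And>M p. M \<in> A \<Longrightarrow> p \<in> intersection_points A \<Longrightarrow> p \<in> M \<Longrightarrow> \<phi> p \<in> \<psi> M"
    and mono: "monotone_between_lines \<phi> (intersection_points A \<inter> L) L (\<psi> L)"
    and L: "L \<in> A"
  shows "\<exists>\<eta>. \<eta> \<in> {1, -1} \<and> (\<forall>M\<in>A. \<forall>N\<in>A. L \<noteq> M \<and> L \<noteq> N \<and> M \<noteq> N \<longrightarrow>
    order_sign (line_form (\<psi> L)) (line_form (\<psi> M)) (line_form (\<psi> N)) =
    \<eta> * order_sign (line_form L) (line_form M) (line_form N))"
proof -
  have zero: "aff (line_form M) p = 0 \<longleftrightarrow> p \<in> M" "aff (line_form (\<psi> M)) p = 0 \<longleftrightarrow> p \<in> \<psi> M"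
    and nonconst: "line_form M $ 1 \<noteq> 0 \<or> line_form M $ 2 \<noteq> 0"
      "line_form (\<psi> M) $ 1 \<noteq> 0 \<or> line_form (\<psi> M) $ 2 \<noteq> 0"
    if "M \<in> A" for M p
  proof -
    have "is_line M" "is_line (\<psi> M)"
      using A B that bij_betwE[OF bij] by (simp_all add: line_arrangement_def)
    then show "aff (line_form M) p = 0 \<longleftrightarrow> p \<in> M" "aff (line_form (\<psi> M)) p = 0 \<longleftrightarrow> p \<in> \<psi> M"
      "line_form M $ 1 \<noteq> 0 \<or> line_form M $ 2 \<noteq> 0"
      "line_form (\<psi> M) $ 1 \<noteq> 0 \<or> line_form (\<psi> M) $ 2 \<noteq> 0"
      using line_form line_form_iff by blast+
  qed
  let ?S = "intersection_points A \<inter> L"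
  have mono': "monotone_between_lines \<phi> ?S {x. aff (line_form L) x = 0} {x. aff (line_form (\<psi> L)) x = 0}"
    using mono zero[OF L] by simp
  have inj': "inj_on \<phi> ?S" using inj by (rule inj_on_subset) blast
  have on': "aff (line_form L) p = 0 \<and> aff (line_form (\<psi> L)) (\<phi> p) = 0" if "p \<in> ?S" for p
    using that on[OF L] zero[OF L] by blast
  show ?thesis
  proof (rule monotone_orientation[OF mono' nonconst[OF L] inj' on'])
    fix \<eta> assume \<eta>: "\<eta> \<in> {1, -1}"
      and main: "\<And>p q c d c' d'. \<lbrakk>p \<in> ?S; q \<in> ?S; p \<noteq> q;
        aff c p = 0; aff d q = 0; aff c' (\<phi> p) = 0; aff d' (\<phi> q) = 0;
        triple_prod (line_form L) c infinity_form \<noteq> 0; triple_prod (line_form L) d infinity_form \<noteq> 0;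
        triple_prod (line_form (\<psi> L)) c' infinity_form \<noteq> 0;
        triple_prod (line_form (\<psi> L)) d' infinity_form \<noteq> 0\<rbrakk> \<Longrightarrow>
        order_sign (line_form (\<psi> L)) c' d' = \<eta> * order_sign (line_form L) c d"
    have "order_sign (line_form (\<psi> L)) (line_form (\<psi> M)) (line_form (\<psi> N)) =
        \<eta> * order_sign (line_form L) (line_form M) (line_form N)"
      if MN: "M \<in> A" "N \<in> A" "L \<noteq> M" "L \<noteq> N" "M \<noteq> N" for M N
    proof -
      obtain p where p: "p \<in> intersection_points A" "p \<in> L" "p \<in> M"
        using intersection_point_of_lines[OF A L MN(1,3)] by blast
      obtain q where q: "q \<in> intersection_points A" "q \<in> L" "q \<in> N"
        using intersection_point_of_lines[OF A L MN(2,4)] by blast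
      have "L \<inter> M \<inter> N = {}" using A L MN unfolding line_arrangement_def by blast
      then have pq: "p \<noteq> q" using p q by blast
      show ?thesis
        by (rule main[OF _ _ pq])
          (use p q L MN on zero line_arrangement_forms(1)[OF A]
            lines_cross_reindex[OF B bij] in \<open>auto simp: lines_cross_def\<close>)
    qed
    then show ?thesis using \<eta> by blast
  qed
qed

theorem theorem4p1:
  fixes \<A>\<^sub>1 \<A>\<^sub>2 :: "('a::linordered_field ^ 2) set set"
    and \<phi> :: "'a ^ 2 \<Rightarrow> 'a ^ 2" and n :: nat
  assumes "line_arrangement n \<A>\<^sub>1" and "line_arrangement n \<A>\<^sub>2"
    and "collineation_isomorphism \<A>\<^sub>1 \<A>\<^sub>2 \<phi>"
    and "preserves_order_on_lines \<A>\<^sub>1 \<A>\<^sub>2 \<phi>"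
  shows "\<exists>f. piecewise_linear_automorphism f \<and> takes_arrangement f \<A>\<^sub>1 \<A>\<^sub>2"
proof -
  let ?A = "\<A>\<^sub>1" and ?B = "\<A>\<^sub>2"
  note A = assms(1) and B = assms(2)
  have finA: "finite ?A" "card ?A = n" and finB: "finite ?B" "card ?B = n"
    and lineA: "\<And>L. L \<in> ?A \<Longrightarrow> is_line L" and lineB: "\<And>L. L \<in> ?B \<Longrightarrow> is_line L"
    using A B by (simp_all add: line_arrangement_def)
  obtain \<psi>\<^sub>0 where \<psi>\<^sub>0: "bij_betw \<psi>\<^sub>0 ?A ?B"
    using finite_same_card_bij[OF finA(1) finB(1)] finA finB by auto
  note forms = lines_cross_reindex[OF B]
  \<comment> \<open>With at most two lines, all lines carry the same intersection points and \<phi>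
    cannot tell them apart. Any bijection of the lines then serves, since the condition on triples
    is empty.\<close>
  consider "n = 0" | "n = 1" | "n = 2" | "3 \<le> n" by linarith
  then show ?thesis
  proof cases
    case 1
    then have "?A = {}" "?B = {}" using finA finB by auto
    moreover obtain f :: "'a ^ 2 \<Rightarrow> 'a ^ 2" where "piecewise_linear_automorphism f"
      using piecewise_linear_automorphism_of_line_pair[of "vector [1, 0, 0]" "vector [1, 0, 0]"]
      by auto
    ultimately show ?thesis by (auto simp: takes_arrangement_def)
  next
    case 2
    then obtain L where L: "?A = {L}" using finA card_1_singletonE by blast
    then have "is_line L" "is_line (\<psi>\<^sub>0 L)" using lineA lineB bij_betwE[OF \<psi>\<^sub>0] by auto
    then obtain f where f: "piecewise_linear_automorphism f"
      "f ` {x. aff (line_form L) x = 0} = {x. aff (line_form (\<psi>\<^sub>0 L)) x = 0}"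
      using piecewise_linear_automorphism_of_line_pair[OF line_form(1) line_form(1)] by blast
    have "takes_arrangement f ?A ?B"
      by (rule takes_arrangement_of_forms[OF A B \<psi>\<^sub>0]) (use f L in simp)
    then show ?thesis using f(1) by blast
  next
    case 3
    have no: False if "i \<in> ?A" "j \<in> ?A" "k \<in> ?A" "i \<noteq> j" "i \<noteq> k" "j \<noteq> k" for i j k
    proof -
      have "card {i, j, k} \<le> card ?A" using that finA by (intro card_mono) auto
      then show False using that 3 finA by simp
    qed
    have "\<exists>f. piecewise_linear_automorphism f \<and> (\<forall>L\<in>?A.
        f ` {x. aff (line_form L) x = 0} = {x. aff (line_form (\<psi>\<^sub>0 L)) x = 0})"
    proof (rule piecewise_linear_automorphism_of_betweenness[where \<eta> = "\<lambda>_. 1"])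
      show "2 \<le> card ?A" using 3 finA by simp
    qed (use no finA(1) line_arrangement_forms[OF A] forms[OF \<psi>\<^sub>0] in blast)+
    then show ?thesis using takes_arrangement_of_forms[OF A B \<psi>\<^sub>0] by metis
  next
    case 4
    have bij\<phi>: "bij_betw \<phi> (intersection_points ?A) (intersection_points ?B)"
      using assms(3) by (simp add: collineation_isomorphism_def)
    have "\<forall>L\<in>?A. \<exists>L'. L' \<in> ?B \<and>
        \<phi> ` (intersection_points ?A \<inter> L) = intersection_points ?B \<inter> L' \<and>
        monotone_between_lines \<phi> (intersection_points ?A \<inter> L) L L'"
      using assms(4) unfolding preserves_order_on_lines_def by blast
    from bchoice[OF this] obtain \<psi> where \<psi>: "\<forall>L\<in>?A. \<psi> L \<in> ?B \<and>
        \<phi> ` (intersection_points ?A \<inter> L) = intersection_points ?B \<inter> \<psi> L \<and>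
        monotone_between_lines \<phi> (intersection_points ?A \<inter> L) L (\<psi> L)" by (elim exE) (rule that)
    have on: "\<phi> p \<in> \<psi> L" if "L \<in> ?A" "p \<in> intersection_points ?A" "p \<in> L" for L p
      using \<psi> that by blast
    \<comment> \<open>A third line meets \<open>L\<close> outside \<open>M\<close>, so different
      lines carry different sets of intersection points, and the injective \<phi> keeps them
      different.\<close>
    have "inj_on \<psi> ?A"
    proof (rule inj_onI, rule ccontr)
      fix L M assume LM: "L \<in> ?A" "M \<in> ?A" "\<psi> L = \<psi> M" "L \<noteq> M"
      then have "\<phi> ` (intersection_points ?A \<inter> L) = \<phi> ` (intersection_points ?A \<inter> M)"
        using \<psi> by simp
      then have eq: "intersection_points ?A \<inter> L = intersection_points ?A \<inter> M"
        using bij\<phi> by (subst (asm) inj_on_image_eq_iff[where C = "intersection_points ?A"]) (auto simp: bij_betw_def)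
      obtain N where N: "N \<in> ?A" "N \<noteq> L" "N \<noteq> M" using exists_third[of ?A L M] 4 finA by auto
      obtain p where p: "p \<in> intersection_points ?A" "p \<in> L" "p \<in> N"
        using intersection_point_of_lines[OF A LM(1) N(1)] N by blast
      then have "p \<in> L \<inter> M \<inter> N" using eq by blast
      moreover have "L \<inter> M \<inter> N = {}" using A LM N unfolding line_arrangement_def by blast
      ultimately show False by blast
    qed
    moreover from this have "card (\<psi> ` ?A) = card ?B" using finA finB by (simp add: card_image)
    then have "\<psi> ` ?A = ?B" using \<psi> finB by (intro card_subset_eq) auto
    ultimately have \<psi>bij: "bij_betw \<psi> ?A ?B" by (simp add: bij_betw_def)
    have "\<forall>L\<in>?A. \<exists>\<eta>. \<eta> \<in> {1, -1} \<and> (\<forall>M\<in>?A. \<forall>N\<in>?A. L \<noteq> M \<and> L \<noteq> N \<and> M \<noteq> N \<longrightarrow>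
        order_sign (line_form (\<psi> L)) (line_form (\<psi> M)) (line_form (\<psi> N)) =
        \<eta> * order_sign (line_form L) (line_form M) (line_form N))"
      using \<psi> on bij\<phi> by (intro ballI matched_lines_order_sign[OF A B \<psi>bij]) (auto simp: bij_betw_def)
    from bchoice[OF this] obtain \<eta> where \<eta>: "\<forall>L\<in>?A. \<eta> L \<in> {1, -1} \<and> (\<forall>M\<in>?A. \<forall>N\<in>?A. L \<noteq> M \<and> L \<noteq> N \<and> M \<noteq> N \<longrightarrow>
        order_sign (line_form (\<psi> L)) (line_form (\<psi> M)) (line_form (\<psi> N)) =
        \<eta> L * order_sign (line_form L) (line_form M) (line_form N))"
      by (elim exE) (rule that)
    have \<eta>pm: "\<eta> L \<in> {1, -1}" if "L \<in> ?A" for L using \<eta> that by blast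
    have rel: "order_sign (line_form (\<psi> L)) (line_form (\<psi> M)) (line_form (\<psi> N)) =
        \<eta> L * order_sign (line_form L) (line_form M) (line_form N)"
      if "L \<in> ?A" "M \<in> ?A" "N \<in> ?A" "L \<noteq> M" "L \<noteq> N" "M \<noteq> N" for L M N
      using \<eta>[THEN bspec, THEN conjunct2, rule_format, OF that(1-3)] that(4-6) by blast
    have "2 \<le> card ?A" using 4 finA by simp
    from piecewise_linear_automorphism_of_betweenness[OF finA(1) this line_arrangement_forms[OF A]
        forms[OF \<psi>bij] \<eta>pm rel]
    obtain f where "piecewise_linear_automorphism f"
      "\<forall>L\<in>?A. f ` {x. aff (line_form L) x = 0} = {x. aff (line_form (\<psi> L)) x = 0}" by blast
    then show ?thesis using takes_arrangement_of_forms[OF A B \<psi>bij, of f] by blast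
  qed
qed

end
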